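(* Let $\mathbf{x}\in\mathbb{R}^N$ and $\mathbf{n}\in\mathbb{R}^M$ be independent random vectors with finite Gaussian mixture distributions $\mathbf{x}\sim\sum_{k\in\mathcal{K}}p_k\,\mathcal{N}(\mathbf{u}^{(k)}_{\mathbf{x}},\mathbf{C}^{(k)}_{\mathbf{xx}})$ and $\mathbf{n}\sim\sum_{l\in\mathcal{L}}q_l\,\mathcal{N}(\mathbf{u}^{(l)}_{\mathbf{n}},\mathbf{C}^{(l)}_{\mathbf{nn}})$, with all covariance matrices positive definite. For a real $M\times N$ matrix $\mathbf{H}$, let $\mathbf{y}=\mathbf{H}\mathbf{x}+\mathbf{n}$, let $\mathbf{u}_{\mathbf{x}|\mathbf{y}}=E\{\mathbf{x}\mid\mathbf{y}\}$ be the MMSE estimator (which depends on $\mathbf{H}$), and set $$g(\mathbf{H})=E\left[\|\mathbf{u}_{\mathbf{x}|\mathbf{y}}\|_2^2\right].$$ For fixed vectors $\mathbf{x},\mathbf{n}$, let $\frac{\partial \breve{G}(\mathbf{H}\mathbf{x}+\mathbf{n})}{\partial\mathbf{H}}$ be the total derivative with respect to $\mathbf{H}$ (holding $\mathbf{x}$ and $\mathbf{n}$ fixed) of $\breve{G}(\mathbf{H}\mathbf{x}+\mathbf{n})=\|\mathbf{u}_{\mathbf{x}|\mathbf{H}\mathbf{x}+\mathbf{n}}\|_2^2$, as specified in the context. Then differentiation and integration may be interchanged, and this stochastic gradient is an unbiased estimator of the gradient of $g$: for every $\mathbf{H}\in\mathbb{R}^{M\times N}$, $g$ is differentiable at $\mathbf{H}$,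 the following expectation is finite, and $$E\left(\frac{\partial \breve{G}(\mathbf{H}\mathbf{x}+\mathbf{n})}{\partial \mathbf{H}}\right)=\iint \frac{\partial \breve{G}(\mathbf{H}\mathbf{x}+\mathbf{n})}{\partial \mathbf{H}}\,f(\mathbf{x})f(\mathbf{n})\,d\mathbf{x}\,d\mathbf{n}=\frac{\partial g(\mathbf{H})}{\partial \mathbf{H}},$$ where $f(\mathbf{x})$ and $f(\mathbf{n})$ denote the densities of $\mathbf{x}$ and $\mathbf{n}$.
   Context: All quantities are real. $\mathcal{K},\mathcal{L}$ are finite index sets, $p_k,q_l\ge 0$, $\sum_{k}p_k=\sum_l q_l=1$. The notation $\mathbf{x}\sim\sum_k p_k\mathcal{N}(\mathbf{u}^{(k)}_{\mathbf{x}},\mathbf{C}^{(k)}_{\mathbf{xx}})$ means that the density of $\mathbf{x}$ is the corresponding convex combination of Gaussian densities; similarly for $\mathbf{n}$. For a scalar function $\phi$ of a matrix $\mathbf{H}$, $\frac{\partial\phi}{\partial\mathbf{H}}$ is the matrix of the same size as $\mathbf{H}$ whose $(i,j)$ entry is $\partial\phi/\partial H_{ij}$. For a matrix $\mathbf{H}$ and $\mathbf{y}\in\mathbb{R}^M$ define $\mathbf{u}^{(k,l)}_{\mathbf{y}}=\mathbf{H}\mathbf{u}^{(k)}_{\mathbf{x}}+\mathbf{u}^{(l)}_{\mathbf{n}}$, $\mathbf{C}^{(k,l)}_{\mathbf{yy}}=\mathbf{H}\mathbf{C}^{(k)}_{\mathbf{xx}}\mathbf{H}^T+\mathbf{C}^{(l)}_{\mathbf{nn}}$,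 let $f^{(k,l)}(\mathbf{y})$ be the density of $\mathcal{N}(\mathbf{u}^{(k,l)}_{\mathbf{y}},\mathbf{C}^{(k,l)}_{\mathbf{yy}})$ at $\mathbf{y}$, and let $\mathbf{u}^{(k,l)}_{\mathbf{x}|\mathbf{y}}=\mathbf{u}^{(k)}_{\mathbf{x}}+\mathbf{C}^{(k)}_{\mathbf{xx}}\mathbf{H}^T(\mathbf{C}^{(k,l)}_{\mathbf{yy}})^{-1}(\mathbf{y}-\mathbf{u}^{(k,l)}_{\mathbf{y}})$. The MMSE estimator is then $$\mathbf{u}_{\mathbf{x}|\mathbf{y}}=\frac{\sum_{k,l}p_kq_lf^{(k,l)}(\mathbf{y})\,\mathbf{u}^{(k,l)}_{\mathbf{x}|\mathbf{y}}}{\sum_{k,l}p_kq_lf^{(k,l)}(\mathbf{y})}.$$ In $\breve{G}(\mathbf{H}\mathbf{x}+\mathbf{n})=\|\mathbf{u}_{\mathbf{x}|\mathbf{H}\mathbf{x}+\mathbf{n}}\|_2^2$ one substitutes $\mathbf{y}=\mathbf{H}\mathbf{x}+\mathbf{n}$ in this formula; the derivative $\frac{\partial \breve{G}(\mathbf{H}\mathbf{x}+\mathbf{n})}{\partial\mathbf{H}}$ takes into account both the dependence on $\mathbf{H}$ through $\mathbf{y}=\mathbf{H}\mathbf{x}+\mathbf{n}$ and the explicit dependence on $\mathbf{H}$ of all quantities in the formula. *)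

theory Defs
  imports "HOL-Probability.Probability"
begin

text \<open>The library constant \<open>indep_var\<close> requires both variables to have the same value type, so
  independence is expressed through \<open>indep_set\<close> for the generated $\sigma$-algebras.\<close>

definition indep_random_vectors ::
  "'a measure \<Rightarrow> ('a \<Rightarrow> real ^ 'n) \<Rightarrow> ('a \<Rightarrow> real ^ 'm) \<Rightarrow> bool" where
  "indep_random_vectors P X W \<longleftrightarrow>
     prob_space.indep_set P (sets (vimage_algebra (space P) X borel))
       (sets (vimage_algebra (space P) W borel))"

definition pos_def_matrix :: "real ^ 'd ^ 'd \<Rightarrow> bool" where
  "pos_def_matrix C \<longleftrightarrow> transpose C = C \<and> (\<forall>v. v \<noteq> 0 \<longrightarrow> v \<bullet> (C *v v) > 0)"

definition gaussian_density :: "real ^ 'd \<Rightarrow> real ^ 'd ^ 'd \<Rightarrow> real ^ 'd \<Rightarrow> real" where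
  "gaussian_density u C z =
     exp (- (1 / 2) * ((z - u) \<bullet> (matrix_inv C *v (z - u)))) / sqrt ((2 * pi) ^ CARD('d) * det C)"

definition mixture_density ::
  "'k set \<Rightarrow> ('k \<Rightarrow> real) \<Rightarrow> ('k \<Rightarrow> real ^ 'd) \<Rightarrow> ('k \<Rightarrow> real ^ 'd ^ 'd) \<Rightarrow> real ^ 'd \<Rightarrow> real" where
  "mixture_density K p u C z = (\<Sum>k\<in>K. p k * gaussian_density (u k) (C k) z)"

definition mean_y :: "real ^ 'n ^ 'm \<Rightarrow> real ^ 'n \<Rightarrow> real ^ 'm \<Rightarrow> real ^ 'm" where
  "mean_y H ux un = H *v ux + un"

definition cov_y :: "real ^ 'n ^ 'm \<Rightarrow> real ^ 'n ^ 'n \<Rightarrow> real ^ 'm ^ 'm \<Rightarrow> real ^ 'm ^ 'm" where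
  "cov_y H Cx Cn = H ** Cx ** transpose H + Cn"

definition component_posterior_mean ::
  "real ^ 'n ^ 'm \<Rightarrow> real ^ 'n \<Rightarrow> real ^ 'n ^ 'n \<Rightarrow> real ^ 'm \<Rightarrow> real ^ 'm ^ 'm \<Rightarrow> real ^ 'm \<Rightarrow> real ^ 'n" where
  "component_posterior_mean H ux Cx un Cn y =
     ux + (Cx ** transpose H ** matrix_inv (cov_y H Cx Cn)) *v (y - mean_y H ux un)"

definition mmse_estimator ::
  "'k set \<Rightarrow> ('k \<Rightarrow> real) \<Rightarrow> ('k \<Rightarrow> real ^ 'n) \<Rightarrow> ('k \<Rightarrow> real ^ 'n ^ 'n) \<Rightarrow>
   'l set \<Rightarrow> ('l \<Rightarrow> real) \<Rightarrow> ('l \<Rightarrow> real ^ 'm) \<Rightarrow> ('l \<Rightarrow> real ^ 'm ^ 'm) \<Rightarrow>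
   real ^ 'n ^ 'm \<Rightarrow> real ^ 'm \<Rightarrow> real ^ 'n" where
  "mmse_estimator K p ux Cx L q un Cn H y =
     (let f = (\<lambda>k l. gaussian_density (mean_y H (ux k) (un l)) (cov_y H (Cx k) (Cn l)) y)
      in (1 / (\<Sum>k\<in>K. \<Sum>l\<in>L. p k * q l * f k l)) *\<^sub>R
         (\<Sum>k\<in>K. \<Sum>l\<in>L. (p k * q l * f k l) *\<^sub>R
            component_posterior_mean H (ux k) (Cx k) (un l) (Cn l) y))"

definition G_breve ::
  "'k set \<Rightarrow> ('k \<Rightarrow> real) \<Rightarrow> ('k \<Rightarrow> real ^ 'n) \<Rightarrow> ('k \<Rightarrow> real ^ 'n ^ 'n) \<Rightarrow>
   'l set \<Rightarrow> ('l \<Rightarrow> real) \<Rightarrow> ('l \<Rightarrow> real ^ 'm) \<Rightarrow> ('l \<Rightarrow> real ^ 'm ^ 'm) \<Rightarrow>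
   real ^ 'n \<Rightarrow> real ^ 'm \<Rightarrow> real ^ 'n ^ 'm \<Rightarrow> real" where
  "G_breve K p ux Cx L q un Cn x n H =
     (norm (mmse_estimator K p ux Cx L q un Cn H (H *v x + n)))\<^sup>2"

definition cond_exp_given ::
  "'a measure \<Rightarrow> ('a \<Rightarrow> real ^ 'n) \<Rightarrow> ('a \<Rightarrow> real ^ 'm) \<Rightarrow> 'a \<Rightarrow> real ^ 'n" where
  "cond_exp_given P X Y \<omega> =
     (\<chi> i. real_cond_exp P (vimage_algebra (space P) Y borel) (\<lambda>\<omega>'. X \<omega>' $ i) \<omega>)"

definition mmse_energy ::
  "'a measure \<Rightarrow> ('a \<Rightarrow> real ^ 'n) \<Rightarrow> ('a \<Rightarrow> real ^ 'm) \<Rightarrow> real ^ 'n ^ 'm \<Rightarrow> real" where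
  "mmse_energy P X W H =
     (LINT \<omega>|P. (norm (cond_exp_given P X (\<lambda>\<omega>'. H *v X \<omega>' + W \<omega>') \<omega>))\<^sup>2)"

text \<open>The entry $(i,j)$ is the partial derivative in $H_{ij}$: only that entry of $H$ is varied.\<close>

definition matrix_gradient :: "(real ^ 'n ^ 'm \<Rightarrow> real) \<Rightarrow> real ^ 'n ^ 'm \<Rightarrow> real ^ 'n ^ 'm" where
  "matrix_gradient \<phi> H =
     (\<chi> i j. deriv (\<lambda>t. \<phi> (\<chi> a b. if a = i \<and> b = j then t else H $ a $ b)) (H $ i $ j))"

end

theory Submission
  imports Defs
begin

text \<open>
  Given \<open>y = H x + n\<close>, completing the square shows that each pair of mixture components contributes
  a Gaussian density in \<open>y\<close> times a Gaussian density in \<open>x\<close> centred at the component posterior mean.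
  Hence the explicit estimator is a version of the conditional expectation, and \<open>g\<close> is the integral of
  \<open>G_breve\<close> against the joint law of \<open>(x, n)\<close>, which does not depend on \<open>H\<close>. The estimator averages
  the component means with softmax weights whose exponents are quadratic in \<open>(x, n)\<close> with coefficients
  smooth in \<open>H\<close>. Softmax weights are bounded by 1, so \<open>G_breve\<close> and its derivative grow at most
  exponentially in the norm of \<open>(x, n)\<close>, locally uniformly in \<open>H\<close>. Gaussian mixtures have all
  exponential moments, and dominated convergence allows differentiation under the integral.
\<close>

section \<open>Linear change of variables\<close>

text \<open>For each H the explicit estimator agrees with the conditional expectation only outside a
  null set that depends on H. Only its integral enters g, but the identity between g and the
  integral of \<open>G_breve\<close> must be available for every H before anything is
  differentiated. Conditional expectation is tested on events in y, without constructing a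
  conditional distribution. The test reduces to the vanishing, for each fixed y, of one x-integral
  against the joint density. The obstacle to the bounds is the denominator of the estimator: the
  reciprocal of the density of y grows like the exponential of a quadratic, beyond every bound that
  Gaussian tails could simply absorb. Hence numerator and denominator are never estimated
  separately. Exponential weights are chosen for their algebra: constants, sums and products only
  raise the rate, and no polynomial degrees have to be tracked. Determinant signs, coercivity and
  Gaussian integrals all come from one matrix B with \<open>transpose B ** C ** B = mat 1\<close>,
  so no spectral theory enters.\<close>

lemma nn_integral_shear:
  fixes f :: "real^'n \<Rightarrow> ennreal"
  assumes [measurable]: "f \<in> borel_measurable borel" and mn: "m \<noteq> n"
  shows "(\<integral>\<^sup>+x. f (x + (x $ n) *\<^sub>R axis m 1) \<partial>lborel) = (\<integral>\<^sup>+x. f x \<partial>lborel)"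
proof -
  let ?e = "axis m 1 :: real^'n" and ?I = "Basis - {axis m 1 :: real^'n}"
  have e: "?e \<in> Basis" by (simp add: axis_in_Basis_iff)
  have fin: "finite ?I" "?e \<notin> ?I" and ins: "insert ?e ?I = Basis" using e by auto
  interpret product_sigma_finite "\<lambda>_::real^'n. lborel::real measure" by standard
  \<comment> \<open>Fubini with coordinate \<open>m\<close> innermost and all other coordinates held
    fixed.\<close>
  have dec: "(\<integral>\<^sup>+x. g x \<partial>lborel) = (\<integral>\<^sup>+x. \<integral>\<^sup>+y. g ((\<Sum>b\<in>?I. x b *\<^sub>R b) + y *\<^sub>R ?e) \<partial>lborel \<partial>(\<Pi>\<^sub>M b\<in>?I. lborel))"
    if [measurable]: "g \<in> borel_measurable borel" for g :: "real^'n \<Rightarrow> ennreal"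
  proof -
    have "(\<integral>\<^sup>+x. g x \<partial>lborel) = (\<integral>\<^sup>+x. g (\<Sum>b\<in>Basis. x b *\<^sub>R b) \<partial>(\<Pi>\<^sub>M b\<in>insert ?e ?I. lborel))"
      unfolding ins by (subst lborel_def) (simp add: nn_integral_distr lborel_eq_real)
    also have "\<dots> = (\<integral>\<^sup>+x. \<integral>\<^sup>+y. g (\<Sum>b\<in>Basis. (x(?e := y)) b *\<^sub>R b) \<partial>lborel \<partial>(\<Pi>\<^sub>M b\<in>?I. lborel))"
    proof (rule product_nn_integral_insert[OF fin])
      show "(\<lambda>x. g (\<Sum>b\<in>Basis. x b *\<^sub>R b)) \<in> borel_measurable (\<Pi>\<^sub>M b\<in>insert ?e ?I. lborel)"
        unfolding ins by measurable
    qed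
    also have "(\<lambda>x y. (\<Sum>b\<in>Basis. (x(?e := y)) b *\<^sub>R b)) = (\<lambda>x y. (\<Sum>b\<in>?I. x b *\<^sub>R b) + y *\<^sub>R ?e)"
    proof (intro ext)
      fix x :: "real^'n \<Rightarrow> real" and y
      have "(\<Sum>b\<in>insert ?e ?I. (x(?e := y)) b *\<^sub>R b) = y *\<^sub>R ?e + (\<Sum>b\<in>?I. (x(?e := y)) b *\<^sub>R b)"
        using fin by (subst sum.insert) auto
      also have "(\<Sum>b\<in>?I. (x(?e := y)) b *\<^sub>R b) = (\<Sum>b\<in>?I. x b *\<^sub>R b)"
        by (intro sum.cong) auto
      finally show "(\<Sum>b\<in>Basis. (x(?e := y)) b *\<^sub>R b) = (\<Sum>b\<in>?I. x b *\<^sub>R b) + y *\<^sub>R ?e"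
        unfolding ins by (simp add: add.commute)
    qed
    finally show ?thesis .
  qed
  have [measurable]: "(\<lambda>x::real^'n. x $ n) \<in> borel_measurable borel" by measurable
  have meas: "(\<lambda>x. f (x + (x $ n) *\<^sub>R ?e)) \<in> borel_measurable borel" by measurable
  show ?thesis
    unfolding dec[OF meas] dec[OF assms(1)]
    proof (rule nn_integral_cong)
      fix x :: "real^'n \<Rightarrow> real"
      \<comment> \<open>Since \<open>m \<noteq> n\<close>, the \<open>n\<close>-th coordinate of
        \<open>v + y *\<^sub>R ?e\<close> is the constant \<open>v $ n\<close>. Along the inner line
        the shear is thus a translation of \<open>y\<close>.\<close>
      define v where "v = (\<Sum>b\<in>?I. x b *\<^sub>R b)"
      have [measurable]: "(\<lambda>y. f (v + y *\<^sub>R ?e)) \<in> borel_measurable borel" by measurable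
      have "(\<integral>\<^sup>+y. f (v + y *\<^sub>R ?e) \<partial>lborel) = (\<integral>\<^sup>+y. f (v + y *\<^sub>R ?e) \<partial>distr lborel borel ((+) (v $ n)))"
        by (simp add: lborel_distr_plus)
      also have "\<dots> = (\<integral>\<^sup>+y. f (v + (v $ n + y) *\<^sub>R ?e) \<partial>lborel)"
        by (subst nn_integral_distr) auto
      also have "\<dots> = (\<integral>\<^sup>+y. f (v + y *\<^sub>R ?e + ((v + y *\<^sub>R ?e) $ n) *\<^sub>R ?e) \<partial>lborel)"
        using mn by (simp add: axis_def algebra_simps)
      finally show "(\<integral>\<^sup>+y. f ((\<Sum>b\<in>?I. x b *\<^sub>R b) + y *\<^sub>R ?e +
               (((\<Sum>b\<in>?I. x b *\<^sub>R b) + y *\<^sub>R ?e) $ n) *\<^sub>R ?e) \<partial>lborel)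
          = (\<integral>\<^sup>+y. f ((\<Sum>b\<in>?I. x b *\<^sub>R b) + y *\<^sub>R ?e) \<partial>lborel)"
        by (simp add: v_def)
    qed
qed

text \<open>Boxes determine Lebesgue measure, and a permutation of the coordinates only reorders the
  side lengths of a box.\<close>

lemma nn_integral_permute_coordinates:
  fixes f :: "real^'n \<Rightarrow> ennreal" and \<pi> :: "'n \<Rightarrow> 'n"
  assumes [measurable]: "f \<in> borel_measurable borel" and \<pi>: "bij \<pi>"
  shows "(\<integral>\<^sup>+x. f (\<chi> i. x $ \<pi> i) \<partial>lborel) = (\<integral>\<^sup>+x. f x \<partial>lborel)"
proof -
  let ?T = "\<lambda>x::real^'n. \<chi> i. x $ \<pi> i"
  have T[measurable]: "?T \<in> borel_measurable borel"
    by (intro borel_measurable_continuous_onI continuous_intros)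
  have "lborel = distr lborel borel ?T"
  proof (rule lborel_eqI)
    fix l u :: "real^'n"
    assume le: "\<And>b. b \<in> Basis \<Longrightarrow> l \<bullet> b \<le> u \<bullet> b"
    have le': "l $ i \<le> u $ i" for i
      using le[of "axis i 1"] by (simp add: inner_axis)
    let ?S = "\<lambda>x::real^'n. \<chi> i. x $ inv \<pi> i"
    have i1: "\<pi> (inv \<pi> j) = j" and i2: "inv \<pi> (\<pi> j) = j" for j
      using \<pi> by (simp_all add: bij_is_surj surj_f_inv_f bij_is_inj)
    have vim: "?T -` box l u = box (?S l) (?S u)"
      by (auto simp: mem_box_cart) (metis i1 i2)+
    have prodB: "(\<Prod>b\<in>Basis. (x::real^'n) \<bullet> b) = (\<Prod>i\<in>UNIV. x $ i)" for x
    proof -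
      have B: "(Basis :: (real^'n) set) = (\<lambda>i. axis i 1) ` UNIV" by (auto simp: Basis_vec_def)
      show ?thesis
        unfolding B by (subst prod.reindex) (auto simp: inj_on_def axis_eq_axis inner_axis)
    qed
    have "emeasure (distr lborel borel ?T) (box l u) = emeasure lborel (box (?S l) (?S u))"
      by (subst emeasure_distr) (auto simp: vim)
    also have "\<dots> = (\<Prod>b\<in>Basis. (?S u - ?S l) \<bullet> b)"
      by (subst emeasure_lborel_box) (auto simp: Basis_vec_def inner_axis le')
    also have "(\<Prod>b\<in>Basis. (?S u - ?S l) \<bullet> b) = (\<Prod>i\<in>UNIV. (u - l) $ inv \<pi> i)"
      unfolding prodB by simp
    also have "\<dots> = (\<Prod>i\<in>UNIV. (u - l) $ i)"
      by (rule prod.reindex_bij_betw) (rule bij_imp_bij_inv[OF \<pi>])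
    also have "\<dots> = (\<Prod>b\<in>Basis. (u - l) \<bullet> b)" unfolding prodB ..
    finally show "emeasure (distr lborel borel ?T) (box l u) = (\<Prod>b\<in>Basis. (u - l) \<bullet> b)" .
  qed simp
  then have "(\<integral>\<^sup>+x. f x \<partial>lborel) = (\<integral>\<^sup>+x. f x \<partial>distr lborel borel ?T)" by simp
  also have "\<dots> = (\<integral>\<^sup>+x. f (?T x) \<partial>lborel)" by (subst nn_integral_distr) auto
  finally show ?thesis ..
qed

lemma nn_integral_diagonal:
  fixes f :: "real^'n \<Rightarrow> ennreal"
  assumes [measurable]: "f \<in> borel_measurable borel" and c: "\<And>i. c i \<noteq> 0"
  shows "ennreal (\<Prod>i\<in>UNIV. \<bar>c i\<bar>) * (\<integral>\<^sup>+x. f (\<chi> i. c i * x $ i) \<partial>lborel) = (\<integral>\<^sup>+x. f x \<partial>lborel)"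
proof -
  define d where "d b = c (axis_index b)" for b :: "real^'n"
  have B: "(Basis :: (real^'n) set) = (\<lambda>i. axis i 1) ` UNIV" by (auto simp: Basis_vec_def)
  have d: "d (axis i 1) = c i" for i by (simp add: d_def axis_index_axis)
  have inj: "inj (\<lambda>i. axis i 1 :: real^'n)" by (simp add: inj_on_def axis_eq_axis)
  have T: "0 + (\<Sum>j\<in>Basis. (d j * (x \<bullet> j)) *\<^sub>R j) = (\<chi> i. c i * x $ i)" for x :: "real^'n"
    unfolding B sum.reindex[OF inj] o_def d inner_axis
    by (simp add: vec_eq_iff axis_def if_distrib cong: if_cong)
  have P: "(\<Prod>j\<in>Basis. \<bar>d j\<bar>) = (\<Prod>i\<in>UNIV. \<bar>c i\<bar>)"
    unfolding B prod.reindex[OF inj] o_def d ..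
  have [measurable]: "(\<lambda>x::real^'n. \<chi> i. c i * x $ i) \<in> borel_measurable borel"
    by (intro borel_measurable_continuous_onI continuous_intros)
  have "lborel = density (distr lborel borel (\<lambda>x::real^'n. \<chi> i. c i * x $ i)) (\<lambda>_. ennreal (\<Prod>i\<in>UNIV. \<bar>c i\<bar>))"
    using lborel_affine_euclidean[of d 0] c unfolding T P by (auto simp: d_def)
  then have "(\<integral>\<^sup>+x. f x \<partial>lborel) = (\<integral>\<^sup>+x. f x \<partial>density (distr lborel borel (\<lambda>x::real^'n. \<chi> i. c i * x $ i)) (\<lambda>_. ennreal (\<Prod>i\<in>UNIV. \<bar>c i\<bar>)))"
    by simp
  also have "\<dots> = ennreal (\<Prod>i\<in>UNIV. \<bar>c i\<bar>) * (\<integral>\<^sup>+x. f (\<chi> i. c i * x $ i) \<partial>lborel)"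
    by (subst nn_integral_density) (auto simp: nn_integral_cmult nn_integral_distr)
  finally show ?thesis ..
qed

text \<open>The library's change of variables requires a well-ordered index type; decomposing into
  elementary matrices removes that restriction.\<close>

lemma nn_integral_linear_change_of_variables:
  fixes T :: "real^'n^'n" and f :: "real^'n \<Rightarrow> ennreal"
  assumes "det T \<noteq> 0" and "f \<in> borel_measurable borel"
  shows "\<bar>det T\<bar> * (\<integral>\<^sup>+x. f (T *v x) \<partial>lborel) = (\<integral>\<^sup>+x. f x \<partial>lborel)"
proof -
  \<comment> \<open>The integrand is quantified inside the induction: for a product, the hypothesis
    for \<open>B\<close> is applied to \<open>f\<close> composed with \<open>A\<close>.\<close>
  have "\<forall>f\<in>borel_measurable borel. det T \<noteq> 0 \<longrightarrow>
      \<bar>det T\<bar> * (\<integral>\<^sup>+x. f (T *v x) \<partial>lborel) = (\<integral>\<^sup>+x. f x \<partial>lborel)"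
  proof (induction T rule: induct_matrix_elementary_alt)
    case (1 A B)
    show ?case
    proof (intro ballI impI)
      fix f :: "real^'n \<Rightarrow> ennreal" assume f[measurable]: "f \<in> borel_measurable borel"
      assume "det (A ** B) \<noteq> 0"
      then have d: "det A \<noteq> 0" "det B \<noteq> 0" by (auto simp: det_mul)
      have [measurable]: "(*v) A \<in> borel_measurable borel"
        by (intro borel_measurable_continuous_onI matrix_vector_mult_linear_continuous_on)
      have "(\<lambda>x. f (A *v x)) \<in> borel_measurable borel" by measurable
      then have "\<bar>det B\<bar> * (\<integral>\<^sup>+x. f (A *v (B *v x)) \<partial>lborel) = (\<integral>\<^sup>+x. f (A *v x) \<partial>lborel)"
        using 1(2)[rule_format, of "\<lambda>x. f (A *v x)"] d by simp
      moreover have "\<bar>det A\<bar> * (\<integral>\<^sup>+x. f (A *v x) \<partial>lborel) = (\<integral>\<^sup>+x. f x \<partial>lborel)"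
        using 1 d f by blast
      ultimately show "\<bar>det (A ** B)\<bar> * (\<integral>\<^sup>+x. f (A ** B *v x) \<partial>lborel) = (\<integral>\<^sup>+x. f x \<partial>lborel)"
        by (simp add: det_mul abs_mult ennreal_mult' matrix_vector_mul_assoc mult.assoc)
    qed
  next
    \<comment> \<open>A zero row makes the determinant 0, so this case is vacuous.\<close>
    case (2 A i)
    then show ?case by (metis det_zero_row(2))
  next
    case (3 A)
    then have det: "det A = (\<Prod>i\<in>UNIV. A $ i $ i)" by (rule det_diagonal)
    have "A *v x = (\<chi> i. A $ i $ i * x $ i)" for x
    proof -
      have "(\<Sum>j\<in>UNIV. A $ i $ j * x $ j) = (\<Sum>j\<in>UNIV. if j = i then A $ i $ i * x $ i else 0)" for i
        by (intro sum.cong) (auto simp: 3)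
      then show ?thesis by (simp add: vec_eq_iff matrix_vector_mult_def)
    qed
    then show ?case
      using nn_integral_diagonal[where c="\<lambda>i. A $ i $ i"] by (auto simp: det abs_prod)
  next
    case (4 m n)
    let ?p = "Transposition.transpose m n"
    have eq: "(\<chi> i j. mat 1 $ i $ ?p j) *v x = (\<chi> i. x $ ?p i)" for x :: "real^'n"
    proof -
      have "(\<Sum>j\<in>UNIV. mat 1 $ i $ ?p j * x $ j) = (\<Sum>j\<in>UNIV. if j = ?p i then x $ j else 0)" for i
        by (intro sum.cong) (auto simp: mat_def transpose_eq_iff)
      then show ?thesis by (simp add: vec_eq_iff matrix_vector_mult_def)
    qed
    have "\<bar>det (\<chi> i j. (mat 1 :: real^'n^'n) $ i $ ?p j)\<bar> = 1"
      using det_permute_columns[of ?p "mat 1 :: real^'n^'n"]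
      by (simp add: permutes_swap_id sign_def)
    then show ?case
      using nn_integral_permute_coordinates[of _ ?p] by (simp add: eq)
  next
    case (5 m n)
    let ?A = "\<chi> i j. of_bool (i = m \<and> j = n \<or> i = j) :: real^'n^'n"
    have eq: "?A *v x = x + (x $ n) *\<^sub>R axis m 1" for x :: "real^'n"
    proof -
      have "(\<Sum>j\<in>UNIV. of_bool (i = m \<and> j = n \<or> i = j) * x $ j)
          = (\<Sum>j\<in>UNIV. (if j = i then x $ j else 0) + (if j = n then (if i = m then x $ n else 0) else 0))" for i
        using 5 by (intro sum.cong) auto
      then show ?thesis by (simp add: vec_eq_iff matrix_vector_mult_def axis_def sum.distrib)
    qed
    have "?A = (\<chi> k. if k = m then row m (mat 1) + 1 *s row n (mat 1) else row k (mat 1))"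
      using 5 by (auto simp: vec_eq_iff row_def mat_def)
    then have d1: "det ?A = 1"
      using det_row_operation[OF 5, of "mat 1 :: real^'n^'n" 1] by simp
    then show ?case
      using nn_integral_shear[OF _ 5] unfolding eq d1 by simp
  qed
  then show ?thesis using assms by blast
qed

section \<open>Positive definite matrices\<close>

lemma pos_def_matrix_sym:
  "pos_def_matrix C \<Longrightarrow> x \<bullet> (C *v y) = (C *v x) \<bullet> y"
  by (metis dot_lmul_matrix pos_def_matrix_def transpose_matrix_vector)

lemma inner_transpose_mult: "x \<bullet> (transpose A *v y) = (A *v x) \<bullet> (y :: real^'m)" for A :: "real^'n^'m"
  by (metis dot_lmul_matrix inner_commute transpose_matrix_vector)

text \<open>Gram-Schmidt for the inner product \<open>\<lambda>x y. x \<bullet> (C *v y)\<close>.\<close>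

lemma pos_def_matrix_congruent_mat_1:
  fixes C :: "real^'d^'d"
  assumes C: "pos_def_matrix C"
  obtains B :: "real^'d^'d" where "transpose B ** C ** B = mat 1"
proof -
  have "\<exists>b::'d \<Rightarrow> real^'d. \<forall>i\<in>S. \<forall>j\<in>S. b i \<bullet> (C *v b j) = (if i = j then 1 else 0)"
    if "finite S" for S :: "'d set"
    using that
  proof induction
    case (insert i S)
    then obtain b :: "'d \<Rightarrow> real^'d" where
      b: "\<And>i j. i \<in> S \<Longrightarrow> j \<in> S \<Longrightarrow> b i \<bullet> (C *v b j) = (if i = j then 1 else 0)" by blast
    let ?V = "(\<lambda>j. C *v b j) ` S"
    \<comment> \<open>Since \<open>i\<close> is not in \<open>S\<close>, fewer than
      \<open>CARD('d)\<close> vectors \<open>C *v b j\<close> are present. A nonzero vector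
      orthogonal to all of them exists and becomes the next direction.\<close>
    have "dim ?V \<le> card S"
      by (rule order_trans[OF dim_le_card' card_image_le]) (use insert in auto)
    also have "\<dots> < CARD('d)"
      using insert by (metis card_mono card_seteq finite_class.finite_UNIV linorder_not_le subset_UNIV UNIV_I)
    finally obtain v where v: "v \<noteq> 0" "\<And>y. y \<in> span ?V \<Longrightarrow> orthogonal v y"
      using orthogonal_to_subspace_exists[of ?V] by auto
    have vC: "v \<bullet> (C *v b j) = 0" if "j \<in> S" for j
      using v(2)[of "C *v b j"] that by (auto simp: orthogonal_def span_base)
    have Cv: "b j \<bullet> (C *v v) = 0" if "j \<in> S" for j
      using vC[OF that] pos_def_matrix_sym[OF C, of "b j" v] by (simp add: inner_commute)
    define s where "s = v \<bullet> (C *v v)"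
    have s: "s > 0" using C v(1) by (simp add: pos_def_matrix_def s_def)
    define w where "w = (1 / sqrt s) *\<^sub>R v"
    have ww: "w \<bullet> (C *v w) = 1"
      using s by (simp add: w_def matrix_vector_mult_scaleR s_def[symmetric])
    have wC: "w \<bullet> (C *v b j) = 0" "b j \<bullet> (C *v w) = 0" if "j \<in> S" for j
      using vC[OF that] Cv[OF that] by (simp_all add: w_def matrix_vector_mult_scaleR)
    have "(b(i := w)) j \<bullet> (C *v (b(i := w)) k) = (if j = k then 1 else 0)"
      if "j \<in> insert i S" "k \<in> insert i S" for j k
      using that insert.hyps(2) ww wC b by (cases "j = i"; cases "k = i") simp_all
    then have F: "\<forall>j\<in>insert i S. \<forall>k\<in>insert i S. (b(i := w)) j \<bullet> (C *v (b(i := w)) k) = (if j = k then 1 else 0)"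
      by (intro ballI)
    show ?case by (intro exI[of _ "b(i := w)"]) (rule F)
  qed simp
  from this[OF finite_class.finite_UNIV] obtain b :: "'d \<Rightarrow> real^'d" where
    "\<forall>i\<in>UNIV. \<forall>j\<in>UNIV. b i \<bullet> (C *v b j) = (if i = j then 1 else 0)" by (rule exE)
  then have b: "b i \<bullet> (C *v b j) = (if i = j then 1 else 0)" for i j by simp
  define B where "B = (\<chi> r c. b c $ r)"
  have "transpose B ** (C ** B) = mat 1"
  proof (intro vec_eq_iff[THEN iffD2] allI)
    fix i j
    have "(transpose B ** (C ** B)) $ i $ j = b i \<bullet> (C *v b j)"
      by (simp add: B_def matrix_matrix_mult_def matrix_vector_mult_def transpose_def inner_vec_def)
    then show "(transpose B ** (C ** B)) $ i $ j = mat 1 $ i $ j" by (simp add: b mat_def)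
  qed
  then show thesis using that by (simp add: matrix_mul_assoc)
qed

lemma congruent_mat_1_det:
  fixes C :: "real^'d^'d"
  assumes "transpose B ** C ** B = mat 1"
  shows "(det B)\<^sup>2 * det C = 1"
  using arg_cong[OF assms, of det] by (simp add: det_mul power2_eq_square mult_ac)

text \<open>A congruence to the identity multiplies the determinant by a square and gives 1, which
  fixes the sign.\<close>

lemma pos_def_matrix_det_pos:
  fixes C :: "real^'a^'a"
  assumes "pos_def_matrix C" shows "det C > 0"
proof -
  from assms obtain B :: "real^'a^'a" where "transpose B ** C ** B = mat 1"
    by (rule pos_def_matrix_congruent_mat_1)
  then have "(det B)\<^sup>2 * det C = 1" by (rule congruent_mat_1_det)
  then have "0 < (det B)\<^sup>2 * det C" by simp
  then show ?thesis using zero_le_power2[of "det B"] by (auto simp: zero_less_mult_iff)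
qed

lemma matrix_inv_of_det_nz:
  fixes A :: "real^'d^'d"
  assumes "det A \<noteq> 0"
  shows "A ** matrix_inv A = mat 1 \<and> matrix_inv A ** A = mat 1"
  using assms someI_ex[of "\<lambda>B. A ** B = mat 1 \<and> B ** A = mat 1"]
  by (simp add: invertible_det_nz[symmetric] invertible_def matrix_inv_def)

lemma pos_def_matrix_inv_right: "pos_def_matrix C \<Longrightarrow> C ** matrix_inv C = mat 1"
  and pos_def_matrix_inv_left: "pos_def_matrix C \<Longrightarrow> matrix_inv C ** C = mat 1"
  using matrix_inv_of_det_nz[of C] pos_def_matrix_det_pos[of C] by auto

lemma pos_def_matrix_inv_right_vec: "pos_def_matrix C \<Longrightarrow> C *v (matrix_inv C *v x) = x"
  and pos_def_matrix_inv_left_vec: "pos_def_matrix C \<Longrightarrow> matrix_inv C *v (C *v x) = x"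
  by (simp_all add: matrix_vector_mul_assoc pos_def_matrix_inv_right pos_def_matrix_inv_left)

lemma pos_def_matrixI:
  fixes C :: "real^'d^'d"
  assumes "\<And>x y. x \<bullet> (C *v y) = (C *v x) \<bullet> y" and "\<And>v. v \<noteq> 0 \<Longrightarrow> v \<bullet> (C *v v) > 0"
  shows "pos_def_matrix C"
proof -
  have "transpose C *v y = C *v y" for y
    by (rule vector_eq_ldot[THEN iffD1]) (simp add: inner_transpose_mult assms(1) del: transpose_matrix_vector)
  then have "transpose C = C" by (simp add: matrix_eq del: transpose_matrix_vector)
  then show ?thesis using assms(2) by (simp add: pos_def_matrix_def)
qed

lemma pos_def_matrix_nonneg: "pos_def_matrix C \<Longrightarrow> v \<bullet> (C *v v) \<ge> 0"
  by (cases "v = 0") (auto simp: pos_def_matrix_def less_imp_le)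

text \<open>Both properties transfer from \<open>C\<close> by writing each vector as
  \<open>C\<close> applied to its preimage under \<open>C\<close>.\<close>

lemma pos_def_matrix_matrix_inv:
  assumes C: "pos_def_matrix C" shows "pos_def_matrix (matrix_inv C)"
proof (rule pos_def_matrixI)
  fix x y show "x \<bullet> (matrix_inv C *v y) = (matrix_inv C *v x) \<bullet> y"
    using pos_def_matrix_sym[OF C, of "matrix_inv C *v x" "matrix_inv C *v y"]
    by (simp add: pos_def_matrix_inv_right_vec[OF C])
next
  fix v :: "real^'a" assume v: "v \<noteq> 0"
  then have "matrix_inv C *v v \<noteq> 0"
    using pos_def_matrix_inv_right_vec[OF C, of v] by auto
  then have "0 < (matrix_inv C *v v) \<bullet> (C *v (matrix_inv C *v v))"
    using C by (simp add: pos_def_matrix_def)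
  then show "0 < v \<bullet> (matrix_inv C *v v)"
    by (simp add: pos_def_matrix_inv_right_vec[OF C] inner_commute)
qed

text \<open>The congruence term is in general only semidefinite; strictness comes from
  \<open>C\<close>. The lemma serves twice: for \<open>cov_y\<close>, and with
  \<open>transpose H\<close> in place of \<open>H\<close> for the precision matrix of the
  posterior.\<close>

lemma pos_def_matrix_congruence_add:
  fixes A :: "real^'n^'n" and C :: "real^'m^'m" and H :: "real^'n^'m"
  assumes A: "pos_def_matrix A" and C: "pos_def_matrix C"
  shows "pos_def_matrix (H ** A ** transpose H + C)"
proof (rule pos_def_matrixI)
  have eq: "x \<bullet> ((H ** A ** transpose H + C) *v y) = (transpose H *v x) \<bullet> (A *v (transpose H *v y)) + x \<bullet> (C *v y)" for x y
    using inner_transpose_mult[of x "transpose H" "A *v (transpose H *v y)"]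
    by (simp add: matrix_vector_mult_add_rdistrib matrix_vector_mul_assoc[symmetric] inner_add_right
        del: transpose_matrix_vector)
  show "x \<bullet> ((H ** A ** transpose H + C) *v y) = ((H ** A ** transpose H + C) *v x) \<bullet> y" for x y
    unfolding eq using pos_def_matrix_sym[OF A] pos_def_matrix_sym[OF C] eq[of y x]
    by (simp add: inner_commute)
  show "0 < v \<bullet> ((H ** A ** transpose H + C) *v v)" if "v \<noteq> 0" for v
    unfolding eq using pos_def_matrix_nonneg[OF A, of "transpose H *v v"] C that
    by (simp add: pos_def_matrix_def add_nonneg_pos del: transpose_matrix_vector)
qed

lemma pos_def_cov_y: "pos_def_matrix Cx \<Longrightarrow> pos_def_matrix Cn \<Longrightarrow> pos_def_matrix (cov_y H Cx Cn)"
  unfolding cov_y_def by (rule pos_def_matrix_congruence_add)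

text \<open>With z = B w and \<open>transpose B ** A ** B = mat 1\<close> the form equals the
  squared norm of w. A bound k for the operator B then gives the constant 1 / k^2, in place of a
  smallest eigenvalue.\<close>

lemma pos_def_matrix_coercive:
  fixes A :: "real^'d^'d"
  assumes "pos_def_matrix A"
  obtains c where "c > 0" "\<And>z. z \<bullet> (A *v z) \<ge> c * (norm z)\<^sup>2"
proof -
  from assms obtain B :: "real^'d^'d" where B: "transpose B ** A ** B = mat 1"
    by (rule pos_def_matrix_congruent_mat_1)
  have "det B \<noteq> 0" using congruent_mat_1_det[OF B] by auto
  then have inv: "B ** matrix_inv B = mat 1" by (simp add: matrix_inv_of_det_nz)
  obtain k where k: "k > 0" "\<And>w. norm (B *v w) \<le> norm w * k"
    using bounded_linear.pos_bounded[OF matrix_vector_mul_bounded_linear[of B]] by blast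
  have "z \<bullet> (A *v z) \<ge> (1 / k\<^sup>2) * (norm z)\<^sup>2" for z
  proof -
    define w where "w = matrix_inv B *v z"
    have z: "z = B *v w" by (simp add: w_def matrix_vector_mul_assoc inv)
    have "z \<bullet> (A *v z) = w \<bullet> ((transpose B ** A ** B) *v w)"
      by (simp add: z matrix_vector_mul_assoc[symmetric] inner_transpose_mult del: transpose_matrix_vector)
    also have "\<dots> = (norm w)\<^sup>2" by (simp add: B power2_norm_eq_inner)
    finally have *: "z \<bullet> (A *v z) = (norm w)\<^sup>2" .
    have "(norm z)\<^sup>2 \<le> (norm w * k)\<^sup>2" using k(2)[of w] z by (simp add: power_mono)
    then show ?thesis using k(1) * by (simp add: field_simps power_mult_distrib)
  qed
  then show thesis using that[of "1 / k\<^sup>2"] k(1) by simp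
qed

section \<open>Gaussian integrals\<close>

text \<open>The integrand factors over the coordinates, and each factor is known from the
  normalisation of \<open>std_normal_density\<close>.\<close>

lemma nn_integral_exp_neg_half_inner:
  "(\<integral>\<^sup>+w. ennreal (exp (- (1/2) * (w \<bullet> w))) \<partial>(lborel :: 'a::euclidean_space measure))
     = ennreal (sqrt ((2 * pi) ^ DIM('a)))"
proof -
  have one: "(\<integral>\<^sup>+x. ennreal (exp (- (1/2) * x\<^sup>2)) \<partial>lborel) = ennreal (sqrt (2 * pi))"
  proof -
    have "(\<integral>\<^sup>+x. ennreal (exp (- (1/2) * x\<^sup>2)) \<partial>lborel)
        = (\<integral>\<^sup>+x. ennreal (sqrt (2 * pi)) * ennreal (std_normal_density x) \<partial>lborel)"
      by (intro nn_integral_cong) (simp add: std_normal_density_def ennreal_mult'[symmetric])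
    also have "\<dots> = ennreal (sqrt (2 * pi)) * (\<integral>\<^sup>+x. ennreal (std_normal_density x) \<partial>lborel)"
      by (rule nn_integral_cmult) simp
    also have "(\<integral>\<^sup>+x. ennreal (std_normal_density x) \<partial>lborel) = 1"
      by (subst nn_integral_eq_integral) simp_all
    finally show ?thesis by simp
  qed
  have "(\<integral>\<^sup>+w. ennreal (exp (- (1/2) * (w \<bullet> w))) \<partial>(lborel::'a measure))
      = (\<integral>\<^sup>+w. (\<Prod>b\<in>Basis. ennreal (exp (- (1/2) * (w \<bullet> b)\<^sup>2))) \<partial>(lborel::'a measure))"
  proof (rule nn_integral_cong)
    fix w :: 'a
    have "- (1/2) * (w \<bullet> w) = (\<Sum>b\<in>Basis. - (1/2) * (w \<bullet> b)\<^sup>2)"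
      by (subst euclidean_inner) (simp add: power2_eq_square sum_distrib_left)
    then show "ennreal (exp (- (1/2) * (w \<bullet> w))) = (\<Prod>b\<in>Basis. ennreal (exp (- (1/2) * (w \<bullet> b)\<^sup>2)))"
      by (simp only: exp_sum[OF finite_Basis] prod_ennreal exp_ge_zero)
  qed
  also have "\<dots> = (\<Prod>b\<in>(Basis::'a set). (\<integral>\<^sup>+x. ennreal (exp (- (1/2) * x\<^sup>2)) \<partial>lborel))"
    by (rule nn_integral_lborel_prod) auto
  also have "\<dots> = ennreal (sqrt ((2 * pi) ^ DIM('a)))"
    unfolding one by (simp add: ennreal_power real_sqrt_power[symmetric] power_mult_distrib)
  finally show ?thesis .
qed

text \<open>Taking \<open>t = m + m\<close> gives the reflection about \<open>m\<close>, which makes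
  the first central moment of a Gaussian vanish.\<close>

lemma integral_lborel_reflect:
  fixes f :: "'a::euclidean_space \<Rightarrow> real"
  assumes "f \<in> borel_measurable borel"
  shows "(\<integral>x. f (t - x) \<partial>lborel) = (\<integral>x. f x \<partial>lborel)"
proof -
  have "lborel = distr lborel borel (\<lambda>x::'a. t - x)"
    using lborel_affine[of "-1" t] by (simp add: density_1)
  then have "(\<integral>x. f x \<partial>lborel) = (\<integral>x. f x \<partial>distr lborel borel (\<lambda>x. t - x))" by simp
  also have "\<dots> = (\<integral>x. f (t - x) \<partial>lborel)" using assms by (subst integral_distr) auto
  finally show ?thesis ..
qed

lemma nn_integral_lborel_translate:
  fixes f :: "'a::euclidean_space \<Rightarrow> ennreal"
  assumes "f \<in> borel_measurable borel"
  shows "(\<integral>\<^sup>+x. f (x - t) \<partial>lborel) = (\<integral>\<^sup>+x. f x \<partial>lborel)"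
proof -
  have "(\<integral>\<^sup>+x. f x \<partial>lborel) = (\<integral>\<^sup>+x. f x \<partial>distr lborel borel ((+) (- t)))"
    by (simp add: lborel_distr_plus)
  also have "\<dots> = (\<integral>\<^sup>+x. f (x - t) \<partial>lborel)" using assms by (subst nn_integral_distr) auto
  finally show ?thesis ..
qed

lemma borel_measurable_matrix_vector_mult [measurable (raw)]:
  fixes A :: "real^'n^'m"
  assumes "f \<in> borel_measurable M"
  shows "(\<lambda>x. A *v f x) \<in> borel_measurable M"
  using measurable_compose[OF assms borel_measurable_continuous_onI[OF matrix_vector_mult_linear_continuous_on[of UNIV A]]]
  by simp

lemma borel_measurable_vec_component [measurable (raw)]:
  fixes f :: "'a \<Rightarrow> real^'n"
  assumes "f \<in> borel_measurable M" shows "(\<lambda>x. f x $ i) \<in> borel_measurable M"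
  using assms by (intro borel_measurable_continuous_on[of "\<lambda>v. v $ i"] continuous_intros)

text \<open>The substitution z = B w with \<open>transpose B ** A ** B = mat 1\<close> turns the
  form into \<open>w \<bullet> w\<close>; its Jacobian is the inverse square root of
  \<open>det A\<close>.\<close>

lemma nn_integral_exp_neg_quadratic_form:
  fixes A :: "real^'d^'d"
  assumes A: "pos_def_matrix A"
  shows "(\<integral>\<^sup>+z. ennreal (exp (- (1/2) * ((z - u) \<bullet> (A *v (z - u))))) \<partial>lborel)
     = ennreal (sqrt ((2 * pi) ^ CARD('d) / det A))"
proof -
  from A obtain B :: "real^'d^'d" where B: "transpose B ** A ** B = mat 1"
    by (rule pos_def_matrix_congruent_mat_1)
  have detB: "(det B)\<^sup>2 * det A = 1" by (rule congruent_mat_1_det[OF B])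
  then have "det B \<noteq> 0" by auto
  have absB: "\<bar>det B\<bar> = sqrt (1 / det A)"
    using detB pos_def_matrix_det_pos[OF A] by (intro real_sqrt_unique[symmetric]) (auto simp: field_simps)
  let ?f = "\<lambda>z. ennreal (exp (- (1/2) * (z \<bullet> (A *v z))))"
  have q: "(B *v w) \<bullet> (A *v (B *v w)) = w \<bullet> w" for w
  proof -
    have "(B *v w) \<bullet> (A *v (B *v w)) = w \<bullet> ((transpose B ** A ** B) *v w)"
      by (simp add: matrix_vector_mul_assoc[symmetric] inner_transpose_mult del: transpose_matrix_vector)
    then show ?thesis by (simp add: B)
  qed
  have "(\<integral>\<^sup>+z. ?f (z - u) \<partial>lborel) = (\<integral>\<^sup>+z. ?f z \<partial>lborel)"
    by (rule nn_integral_lborel_translate) measurable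
  also have "\<dots> = \<bar>det B\<bar> * (\<integral>\<^sup>+w. ?f (B *v w) \<partial>lborel)"
    by (rule nn_integral_linear_change_of_variables[symmetric]) (use \<open>det B \<noteq> 0\<close> in auto)
  also have "\<dots> = \<bar>det B\<bar> * ennreal (sqrt ((2 * pi) ^ CARD('d)))"
    unfolding q nn_integral_exp_neg_half_inner by simp
  also have "\<dots> = ennreal (sqrt ((2 * pi) ^ CARD('d) / det A))"
    unfolding absB using pos_def_matrix_det_pos[OF A]
    by (simp add: ennreal_mult'[symmetric] real_sqrt_mult real_sqrt_divide)
  finally show ?thesis .
qed

text \<open>Coercivity bounds the quadratic exponent by - (c/2) t^2 with t = norm (z - u). Half of
  this decay pays for the linear term, and the other half leaves an integrable isotropic
  Gaussian.\<close>

lemma integrable_exp_norm_quadratic_form: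
  fixes A :: "real^'d^'d"
  assumes A: "pos_def_matrix A"
  shows "integrable lborel (\<lambda>z. exp (k * norm z) * exp (- (1/2) * ((z - u) \<bullet> (A *v (z - u)))))"
proof -
  from A obtain c where c: "c > 0" "\<And>z. z \<bullet> (A *v z) \<ge> c * (norm z)\<^sup>2"
    by (rule pos_def_matrix_coercive) blast
  \<comment> \<open>This multiple of the identity, together with the factor 1/2 in the exponent,
    produces the remaining decay c/4.\<close>
  have M: "((c / 2) *\<^sub>R mat 1 :: real^'d^'d) *v v = (c / 2) *\<^sub>R v" for v
    by (simp add: scaleR_matrix_vector_assoc[symmetric])
  have pd: "pos_def_matrix ((c / 2) *\<^sub>R mat 1 :: real^'d^'d)"
    using c(1) by (intro pos_def_matrixI) (auto simp: M)
  have "integrable lborel (\<lambda>z::real^'d. exp (- (1/2) * ((z - u) \<bullet> (((c / 2) *\<^sub>R mat 1) *v (z - u)))))"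
    by (rule integrableI_bounded) (use nn_integral_exp_neg_quadratic_form[OF pd, of u] in auto)
  then have int: "integrable lborel (\<lambda>z::real^'d. exp (\<bar>k\<bar> * norm u + k\<^sup>2 / c) * exp (- (c/4) * (norm (z - u))\<^sup>2))"
    by (intro integrable_mult_right) (simp add: M power2_norm_eq_inner mult.commute)
  show ?thesis
  proof (rule Bochner_Integration.integrable_bound[OF int], measurable, intro AE_I2)
    fix z
    define t where "t = norm (z - u)"
    have "k * norm z \<le> \<bar>k\<bar> * norm z" by (simp add: mult_right_mono)
    also have "\<dots> \<le> \<bar>k\<bar> * (norm u + t)"
      using norm_triangle_ineq[of u "z - u"] by (intro mult_left_mono) (auto simp: t_def)
    finally have 1: "k * norm z \<le> \<bar>k\<bar> * norm u + \<bar>k\<bar> * t" by (simp add: algebra_simps)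
    \<comment> \<open>Completing the square trades the linear term for c/4 of the quadratic decay
      and the constant k^2 / c.\<close>
    have "0 \<le> (c * t / 2 - \<bar>k\<bar>)\<^sup>2 / c" using c(1) by simp
    then have 2: "\<bar>k\<bar> * t \<le> c / 4 * t\<^sup>2 + k\<^sup>2 / c"
      using c(1) by (simp add: power2_eq_square field_simps)
    have 3: "- (1/2) * ((z - u) \<bullet> (A *v (z - u))) \<le> - (c / 2) * t\<^sup>2"
      using c(2)[of "z - u"] by (simp add: t_def)
    have "k * norm z + - (1/2) * ((z - u) \<bullet> (A *v (z - u)))
      \<le> (\<bar>k\<bar> * norm u + k\<^sup>2 / c) + - (c / 4) * t\<^sup>2" using 1 2 3 by simp
    then show "norm (exp (k * norm z) * exp (- (1/2) * ((z - u) \<bullet> (A *v (z - u)))))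
      \<le> norm (exp (\<bar>k\<bar> * norm u + k\<^sup>2 / c) * exp (- (c / 4) * (norm (z - u))\<^sup>2))"
      by (simp add: exp_add[symmetric] t_def)
  qed
qed

lemma borel_measurable_gaussian_density [measurable]: "gaussian_density u C \<in> borel_measurable borel"
  unfolding gaussian_density_def by measurable

lemma gaussian_density_pos: "pos_def_matrix C \<Longrightarrow> gaussian_density u C z > 0"
  by (simp add: gaussian_density_def pos_def_matrix_det_pos)

lemma nn_integral_gaussian_density:
  fixes C :: "real^'d^'d"
  assumes C: "pos_def_matrix C"
  shows "(\<integral>\<^sup>+z. ennreal (gaussian_density u C z) \<partial>lborel) = 1"
proof -
  define s where "s = sqrt ((2 * pi) ^ CARD('d) * det C)"
  have dC: "det C > 0" by (rule pos_def_matrix_det_pos[OF C])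
  have s: "s > 0" using dC by (simp add: s_def)
  have "det C * det (matrix_inv C) = 1"
    using arg_cong[OF pos_def_matrix_inv_right[OF C], of det] by (simp add: det_mul)
  then have di: "1 / det (matrix_inv C) = det C"
    using dC by (metis mult.commute nonzero_eq_divide_eq zero_neq_one mult_zero_right)
  have "(\<integral>\<^sup>+z. ennreal (gaussian_density u C z) \<partial>lborel)
     = (\<integral>\<^sup>+z. ennreal (1 / s) * ennreal (exp (- (1/2) * ((z - u) \<bullet> (matrix_inv C *v (z - u))))) \<partial>lborel)"
    using s by (intro nn_integral_cong) (simp add: gaussian_density_def s_def ennreal_mult'[symmetric])
  also have "\<dots> = ennreal (1 / s) * (\<integral>\<^sup>+z. ennreal (exp (- (1/2) * ((z - u) \<bullet> (matrix_inv C *v (z - u))))) \<partial>lborel)"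
    by (rule nn_integral_cmult) measurable
  also have "\<dots> = ennreal (1 / s) * ennreal s"
    unfolding nn_integral_exp_neg_quadratic_form[OF pos_def_matrix_matrix_inv[OF C]]
    by (simp add: s_def di[symmetric])
  also have "\<dots> = 1" using s by (simp add: ennreal_mult'[symmetric])
  finally show ?thesis .
qed

lemma integrable_exp_norm_gaussian_density:
  assumes C: "pos_def_matrix C"
  shows "integrable lborel (\<lambda>z. exp (k * norm z) * gaussian_density u C z)"
proof -
  have "integrable lborel (\<lambda>z. (exp (k * norm z) * exp (- (1/2) * ((z - u) \<bullet> (matrix_inv C *v (z - u)))))
      * (1 / sqrt ((2 * pi) ^ CARD('a) * det C)))"
    by (intro integrable_mult_left integrable_exp_norm_quadratic_form pos_def_matrix_matrix_inv C)
  then show ?thesis by (simp add: gaussian_density_def)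
qed

section \<open>The posterior mean\<close>

text \<open>Completing the square in \<open>x\<close>, with \<open>A\<close> as posterior precision.
  No inversion formula for \<open>cov_y\<close> is used: applying its inverse to the residual gives
  a vector v, and with w = Cx H^T v the residual splits as H w + Cn v while the posterior mean is ux
  + w. The double transpose in \<open>A\<close> matches
  \<open>pos_def_matrix_congruence_add\<close>.\<close>

lemma posterior_quadratic_form:
  fixes H :: "real^'n^'m" and Cx :: "real^'n^'n" and Cn :: "real^'m^'m"
    and ux :: "real^'n" and un :: "real^'m" and y :: "real^'m"
  assumes Cx: "pos_def_matrix Cx" and Cn: "pos_def_matrix Cn"
  defines "A \<equiv> transpose H ** matrix_inv Cn ** transpose (transpose H) + matrix_inv Cx"
  defines "m \<equiv> component_posterior_mean H ux Cx un Cn y"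
  shows "(x - ux) \<bullet> (matrix_inv Cx *v (x - ux)) + (y - H *v x - un) \<bullet> (matrix_inv Cn *v (y - H *v x - un))
    = (y - mean_y H ux un) \<bullet> (matrix_inv (cov_y H Cx Cn) *v (y - mean_y H ux un)) + (x - m) \<bullet> (A *v (x - m))"
proof -
  define b where "b = y - mean_y H ux un"
  define v where "v = matrix_inv (cov_y H Cx Cn) *v b"
  define w where "w = Cx *v (transpose H *v v)"
  define d where "d = x - m"
  define s where "s = (\<lambda>z. matrix_inv Cx *v z)"
  define t where "t = (\<lambda>z. matrix_inv Cn *v z)"
  have Cy: "pos_def_matrix (cov_y H Cx Cn)" by (rule pos_def_cov_y[OF Cx Cn])
  have b: "b = H *v w + Cn *v v"
    using pos_def_matrix_inv_right_vec[OF Cy, of b, folded v_def]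
    by (simp add: cov_y_def w_def matrix_vector_mult_add_rdistrib matrix_vector_mul_assoc[symmetric]
        del: transpose_matrix_vector)
  have m: "m = ux + w"
    by (simp add: m_def component_posterior_mean_def w_def v_def b_def matrix_vector_mul_assoc[symmetric]
        del: transpose_matrix_vector)
  have a: "x - ux = w + d" by (simp add: d_def m)
  have e: "y - H *v x - un = Cn *v v - H *v d"
  proof -
    have "y - H *v x - un = b - H *v (x - ux)"
      by (simp add: b_def mean_y_def matrix_vector_mult_diff_distrib)
    then show ?thesis by (simp add: a b matrix_vector_right_distrib)
  qed
  have sadd: "s (p + q) = s p + s q" for p q by (simp add: s_def matrix_vector_right_distrib)
  have tdiff: "t (p - q) = t p - t q" for p q by (simp add: t_def matrix_vector_mult_diff_distrib)
  have sw: "s w = transpose H *v v" by (simp add: s_def w_def pos_def_matrix_inv_left_vec[OF Cx])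
  have tv: "t (Cn *v v) = v" by (simp add: t_def pos_def_matrix_inv_left_vec[OF Cn])
  have ssym: "w \<bullet> s d = d \<bullet> s w"
    using pos_def_matrix_sym[OF pos_def_matrix_matrix_inv[OF Cx], of w d] by (simp add: s_def inner_commute)
  have tsym: "(Cn *v v) \<bullet> t (H *v d) = (H *v d) \<bullet> v"
    using pos_def_matrix_sym[OF pos_def_matrix_matrix_inv[OF Cn], of "Cn *v v" "H *v d"] tv
    by (simp add: t_def inner_commute)
  have Hs: "z \<bullet> (transpose H *v v) = (H *v z) \<bullet> v" for z by (rule inner_transpose_mult)
  have A: "d \<bullet> (A *v d) = (H *v d) \<bullet> t (H *v d) + d \<bullet> s d"
    unfolding A_def t_def s_def
    by (simp add: matrix_vector_mult_add_rdistrib matrix_vector_mul_assoc[symmetric] inner_add_right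
        inner_transpose_mult transpose_transpose del: transpose_matrix_vector)
  \<comment> \<open>The mixed terms are twice \<open>(H *v d) \<bullet> v\<close> with opposite
    signs and cancel. The terms free of \<open>d\<close> add up to
    \<open>b \<bullet> v\<close>.\<close>
  have "(w + d) \<bullet> s (w + d) + (Cn *v v - H *v d) \<bullet> t (Cn *v v - H *v d) = b \<bullet> v + d \<bullet> (A *v d)"
    unfolding A b sadd tdiff tv
    by (simp add: inner_add_left inner_add_right inner_diff_left inner_diff_right ssym sw Hs tsym matrix_vector_right_distrib
        del: transpose_matrix_vector)
  then show ?thesis
    unfolding a e d_def[symmetric] b_def[symmetric] v_def[symmetric] s_def t_def .
qed

lemma borel_measurable_component_posterior_mean [measurable]:
  "component_posterior_mean H ux Cx un Cn \<in> borel_measurable borel"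
  unfolding component_posterior_mean_def by measurable

text \<open>The scalar \<open>\<kappa>\<close> is determined by comparing total masses, which avoids the determinant identity
  \<open>det Cx * det Cn = det (cov_y H Cx Cn) / det A\<close>.\<close>

lemma gaussian_density_disintegration:
  fixes H :: "real^'n^'m" and Cx :: "real^'n^'n" and Cn :: "real^'m^'m"
    and ux :: "real^'n" and un :: "real^'m"
  assumes Cx: "pos_def_matrix Cx" and Cn: "pos_def_matrix Cn"
  defines "m \<equiv> component_posterior_mean H ux Cx un Cn"
    and "fy \<equiv> gaussian_density (mean_y H ux un) (cov_y H Cx Cn)"
  obtains A :: "real^'n^'n" and \<kappa> where "pos_def_matrix A" "\<kappa> > 0"
    "\<And>x y. gaussian_density ux Cx x * gaussian_density un Cn (y - H *v x)
       = fy y * (\<kappa> * exp (- (1/2) * ((x - m y) \<bullet> (A *v (x - m y)))))"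
    "\<And>u. (\<integral>\<^sup>+x. ennreal (\<kappa> * exp (- (1/2) * ((x - u) \<bullet> (A *v (x - u))))) \<partial>lborel) = 1"
proof -
  define A where "A = transpose H ** matrix_inv Cn ** transpose (transpose H) + matrix_inv Cx"
  have A: "pos_def_matrix A"
    unfolding A_def by (intro pos_def_matrix_congruence_add pos_def_matrix_matrix_inv Cx Cn)
  have Cy: "pos_def_matrix (cov_y H Cx Cn)" by (rule pos_def_cov_y[OF Cx Cn])
  define sx where "sx = sqrt ((2 * pi) ^ CARD('n) * det Cx)"
  define sn where "sn = sqrt ((2 * pi) ^ CARD('m) * det Cn)"
  define sy where "sy = sqrt ((2 * pi) ^ CARD('m) * det (cov_y H Cx Cn))"
  have pos: "sx > 0" "sn > 0" "sy > 0"
    using pos_def_matrix_det_pos[OF Cx] pos_def_matrix_det_pos[OF Cn] pos_def_matrix_det_pos[OF Cy]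
    by (simp_all add: sx_def sn_def sy_def)
  \<comment> \<open>The quotient of the three normalising constants. That it also normalises the
    Gaussian in \<open>x\<close> is known only after the comparison of masses.\<close>
  define \<kappa> where "\<kappa> = sy / (sx * sn)"
  have \<kappa>: "\<kappa> > 0" using pos by (simp add: \<kappa>_def)
  let ?q = "\<lambda>u x. exp (- (1/2) * ((x - u) \<bullet> (A *v (x - u))))"
  have factor: "gaussian_density ux Cx x * gaussian_density un Cn (y - H *v x) = fy y * (\<kappa> * ?q (m y) x)" for x y
  proof -
    have "gaussian_density ux Cx x * gaussian_density un Cn (y - H *v x)
      = exp (- (1/2) * ((x - ux) \<bullet> (matrix_inv Cx *v (x - ux)) + (y - H *v x - un) \<bullet> (matrix_inv Cn *v (y - H *v x - un)))) / (sx * sn)"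
      by (simp add: gaussian_density_def sx_def sn_def exp_add[symmetric] add_divide_distrib)
    also have "\<dots> = exp (- (1/2) * ((y - mean_y H ux un) \<bullet> (matrix_inv (cov_y H Cx Cn) *v (y - mean_y H ux un))
          + (x - m y) \<bullet> (A *v (x - m y)))) / (sx * sn)"
      unfolding posterior_quadratic_form[OF Cx Cn] A_def m_def ..
    also have "\<dots> = fy y * (\<kappa> * ?q (m y) x)"
    proof -
      have "fy y = exp (- (1/2) * ((y - mean_y H ux un) \<bullet> (matrix_inv (cov_y H Cx Cn) *v (y - mean_y H ux un)))) / sy"
        unfolding fy_def gaussian_density_def sy_def ..
      then show ?thesis
        using pos unfolding distrib_left exp_add by (simp only: \<kappa>_def) simp
    qed
    finally show ?thesis .
  qed
  define Z where "Z = sqrt ((2 * pi) ^ CARD('n) / det A)"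
  have Z: "(\<integral>\<^sup>+x. ennreal (\<kappa> * ?q u x) \<partial>lborel) = ennreal (\<kappa> * Z)" for u
  proof -
    have "(\<integral>\<^sup>+x. ennreal (\<kappa> * ?q u x) \<partial>lborel) = (\<integral>\<^sup>+x. ennreal \<kappa> * ennreal (?q u x) \<partial>lborel)"
      using \<kappa> by (simp add: ennreal_mult')
    also have "\<dots> = ennreal \<kappa> * (\<integral>\<^sup>+x. ennreal (?q u x) \<partial>lborel)" by (rule nn_integral_cmult) measurable
    also have "\<dots> = ennreal (\<kappa> * Z)"
      unfolding nn_integral_exp_neg_quadratic_form[OF A] Z_def using \<kappa> by (simp add: ennreal_mult')
    finally show ?thesis .
  qed
  have [measurable]: "fy \<in> borel_measurable borel" by (simp add: fy_def)
  have fy0: "fy y > 0" for y by (simp add: fy_def gaussian_density_pos[OF Cy])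
  have gx0: "gaussian_density ux Cx x \<ge> 0" for x by (rule less_imp_le) (rule gaussian_density_pos[OF Cx])
  \<comment> \<open>The factorised joint density is integrated over both variables. Integrating
    \<open>x\<close> first gives \<open>\<kappa> * Z\<close>; integrating \<open>y\<close> first
    gives 1, since both original factors are probability densities.\<close>
  have "ennreal (\<kappa> * Z) = (\<integral>\<^sup>+y. ennreal (fy y) \<partial>lborel) * ennreal (\<kappa> * Z)"
    unfolding fy_def nn_integral_gaussian_density[OF Cy] by simp
  also have "\<dots> = (\<integral>\<^sup>+y. ennreal (fy y) * ennreal (\<kappa> * Z) \<partial>lborel)"
    by (rule nn_integral_multc[symmetric]) measurable
  also have "\<dots> = (\<integral>\<^sup>+y. \<integral>\<^sup>+x. ennreal (gaussian_density ux Cx x * gaussian_density un Cn (y - H *v x)) \<partial>lborel \<partial>lborel)"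
    unfolding factor ennreal_mult'[OF less_imp_le[OF fy0]]
    by (rule nn_integral_cong, subst nn_integral_cmult, measurable, simp only: Z)
  also have "\<dots> = (\<integral>\<^sup>+x. \<integral>\<^sup>+y. ennreal (gaussian_density ux Cx x * gaussian_density un Cn (y - H *v x)) \<partial>lborel \<partial>lborel)"
    by (rule lborel_pair.Fubini') measurable
  also have "\<dots> = (\<integral>\<^sup>+x. ennreal (gaussian_density ux Cx x) * 1 \<partial>lborel)"
  proof (rule nn_integral_cong)
    fix x
    have "(\<integral>\<^sup>+y. ennreal (gaussian_density ux Cx x * gaussian_density un Cn (y - H *v x)) \<partial>lborel)
       = ennreal (gaussian_density ux Cx x) * (\<integral>\<^sup>+y. ennreal (gaussian_density un Cn (y - H *v x)) \<partial>lborel)"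
      unfolding ennreal_mult'[OF gx0] by (rule nn_integral_cmult) measurable
    also have "(\<integral>\<^sup>+y. ennreal (gaussian_density un Cn (y - H *v x)) \<partial>lborel) = 1"
      by (subst nn_integral_lborel_translate) (simp_all add: nn_integral_gaussian_density[OF Cn])
    finally show "(\<integral>\<^sup>+y. ennreal (gaussian_density ux Cx x * gaussian_density un Cn (y - H *v x)) \<partial>lborel)
       = ennreal (gaussian_density ux Cx x) * 1" .
  qed
  also have "\<dots> = 1" by (simp add: nn_integral_gaussian_density[OF Cx])
  finally show thesis
    using that[OF A \<kappa> factor] Z by simp
qed

text \<open>For fixed \<open>y\<close> the product is \<open>fy\<close> times a normalised Gaussian
  in \<open>x\<close> centred at \<open>m\<close>. The two claims are its mass and its first moment;
  the latter follows from symmetry about \<open>m\<close>.\<close>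

lemma gaussian_posterior:
  fixes H :: "real^'n^'m" and Cx :: "real^'n^'n" and Cn :: "real^'m^'m"
    and ux :: "real^'n" and un :: "real^'m" and y :: "real^'m"
  assumes Cx: "pos_def_matrix Cx" and Cn: "pos_def_matrix Cn"
  defines "m \<equiv> component_posterior_mean H ux Cx un Cn y"
    and "fy \<equiv> gaussian_density (mean_y H ux un) (cov_y H Cx Cn) y"
  shows "has_bochner_integral lborel (\<lambda>x. gaussian_density ux Cx x * gaussian_density un Cn (y - H *v x)) fy"
    and "has_bochner_integral lborel (\<lambda>x. x $ i * (gaussian_density ux Cx x * gaussian_density un Cn (y - H *v x))) (fy * m $ i)"
proof -
  obtain A :: "real^'n^'n" and \<kappa> where A: "pos_def_matrix A" and \<kappa>: "\<kappa> > 0"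
    and f': "\<And>x y. gaussian_density ux Cx x * gaussian_density un Cn (y - H *v x)
       = gaussian_density (mean_y H ux un) (cov_y H Cx Cn) y *
         (\<kappa> * exp (- (1/2) * ((x - component_posterior_mean H ux Cx un Cn y) \<bullet>
            (A *v (x - component_posterior_mean H ux Cx un Cn y)))))"
    and I: "\<And>u. (\<integral>\<^sup>+x. ennreal (\<kappa> * exp (- (1/2) * ((x - u) \<bullet> (A *v (x - u))))) \<partial>lborel) = 1"
    by (rule gaussian_density_disintegration[OF Cx Cn, where ux = ux and H = H and un = un]) blast
  note f = f'[of _ y, folded m_def fy_def]
  let ?q = "\<lambda>x. \<kappa> * exp (- (1/2) * ((x - m) \<bullet> (A *v (x - m))))"
  have q: "has_bochner_integral lborel ?q 1"
    using \<kappa> I[of m] by (intro has_bochner_integral_nn_integral) auto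
  show "has_bochner_integral lborel (\<lambda>x. gaussian_density ux Cx x * gaussian_density un Cn (y - H *v x)) fy"
    unfolding f using has_bochner_integral_mult_right[OF q, of fy] by simp
  \<comment> \<open>Rate 1 suffices to dominate the first moment, because a coordinate of
    \<open>x\<close> is at most \<open>exp (norm x)\<close> in absolute value.\<close>
  have bound: "integrable lborel (\<lambda>x. exp (1 * norm x) * exp (- (1/2) * ((x - m) \<bullet> (A *v (x - m)))))"
    by (rule integrable_exp_norm_quadratic_form[OF A])
  have int: "integrable lborel (\<lambda>x. x $ i * ?q x)"
  proof (rule Bochner_Integration.integrable_bound[OF integrable_mult_right[OF bound, of \<kappa>]], measurable, intro AE_I2)
    fix x
    have "\<bar>x $ i\<bar> \<le> exp (norm x)"
      using component_le_norm_cart[of x i] exp_ge_add_one_self[of "norm x"] by linarith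
    then show "norm (x $ i * ?q x) \<le> norm (\<kappa> * (exp (1 * norm x) * exp (- (1/2) * ((x - m) \<bullet> (A *v (x - m))))))"
      using \<kappa> by (simp add: abs_mult mult_right_mono)
  qed
  have q1: "integrable lborel ?q" and "(\<integral>x. ?q x \<partial>lborel) = 1" using q by (simp_all add: has_bochner_integral_iff)
  have int': "integrable lborel (\<lambda>x. (x $ i - m $ i) * ?q x)"
    unfolding left_diff_distrib by (rule Bochner_Integration.integrable_diff[OF int integrable_mult_right[OF q1]])
  \<comment> \<open>The reflection \<open>m + m - x\<close> preserves the Gaussian and changes the
    sign of \<open>x $ i - m $ i\<close>, so the integral of \<open>?F\<close> equals its own
    negative.\<close>
  let ?F = "\<lambda>x. (x $ i - m $ i) * ?q x"
  have "(\<integral>x. ?F x \<partial>lborel) = (\<integral>x. ?F ((m + m) - x) \<partial>lborel)"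
    by (rule integral_lborel_reflect[symmetric]) measurable
  also have "(\<lambda>x. ?F ((m + m) - x)) = (\<lambda>x. - ?F x)"
  proof
    fix x
    have "m + m - x - m = - (x - m)" by simp
    then have "(m + m - x - m) \<bullet> (A *v (m + m - x - m)) = (x - m) \<bullet> (A *v (x - m))"
      using matrix_vector_mult_scaleR[of A "-1" "x - m"] by (simp only: scaleR_minus1_left inner_minus_left inner_minus_right minus_minus)
    then show "?F ((m + m) - x) = - ?F x" by (simp add: algebra_simps)
  qed
  finally have "(\<integral>x. ?F x \<partial>lborel) = 0" by simp
  moreover have "(\<integral>x. ?F x \<partial>lborel) = (\<integral>x. x $ i * ?q x \<partial>lborel) - m $ i * (\<integral>x. ?q x \<partial>lborel)"
    unfolding left_diff_distrib using int \<open>integrable lborel ?q\<close>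
    by (subst Bochner_Integration.integral_diff) auto
  ultimately have "(\<integral>x. x $ i * ?q x \<partial>lborel) = m $ i" using \<open>(\<integral>x. ?q x \<partial>lborel) = 1\<close> by simp
  then have "has_bochner_integral lborel (\<lambda>x. x $ i * ?q x) (m $ i)"
    using int by (simp add: has_bochner_integral_iff)
  from has_bochner_integral_mult_right[OF this, of fy]
  show "has_bochner_integral lborel (\<lambda>x. x $ i * (gaussian_density ux Cx x * gaussian_density un Cn (y - H *v x))) (fy * m $ i)"
    unfolding f by (simp add: mult_ac)
qed

section \<open>Posterior mean of the mixture model\<close>

lemma borel_measurable_mixture_density [measurable]: "mixture_density K p u C \<in> borel_measurable borel"
  unfolding mixture_density_def by measurable

lemma borel_measurable_mmse_estimator [measurable]:
  "mmse_estimator K p ux Cx L q un Cn H \<in> borel_measurable borel"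
  unfolding mmse_estimator_def Let_def by measurable

lemma mixture_density_nonneg:
  "(\<And>k. k \<in> K \<Longrightarrow> p k \<ge> 0) \<Longrightarrow> (\<And>k. k \<in> K \<Longrightarrow> pos_def_matrix (C k)) \<Longrightarrow> mixture_density K p u C z \<ge> 0"
  unfolding mixture_density_def by (intro sum_nonneg mult_nonneg_nonneg) (auto intro: less_imp_le gaussian_density_pos)

text \<open>A component of positive weight keeps the denominators of the estimator and of the
  softmax weights positive.\<close>

lemma sum_eq_1_obtain_pos:
  fixes p :: "'k \<Rightarrow> real"
  assumes "\<And>k. k \<in> K \<Longrightarrow> p k \<ge> 0" "(\<Sum>k\<in>K. p k) = 1"
  obtains k where "k \<in> K" "p k > 0"
proof -
  have "\<exists>k\<in>K. p k > 0"
  proof (rule ccontr)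
    assume "\<not> (\<exists>k\<in>K. p k > 0)"
    then have "\<And>k. k \<in> K \<Longrightarrow> p k = 0" using assms(1) by (metis less_eq_real_def)
    then show False using assms(2) by simp
  qed
  then show thesis using that by blast
qed

text \<open>Summing the component masses and first moments with weights \<open>p k * q l\<close>
  gives \<open>?S\<close> and \<open>?S * u $ i\<close>, and the difference cancels. This is the
  defining property of the conditional mean in a form that holds for every single
  \<open>y\<close>.\<close>

lemma mmse_estimator_posterior_mean:
  fixes H :: "real^'n^'m"
  assumes K: "finite K" "\<And>k. k \<in> K \<Longrightarrow> p k \<ge> 0" "(\<Sum>k\<in>K. p k) = 1"
    and L: "finite L" "\<And>l. l \<in> L \<Longrightarrow> q l \<ge> 0" "(\<Sum>l\<in>L. q l) = 1"
    and Cx: "\<And>k. k \<in> K \<Longrightarrow> pos_def_matrix (Cx k)" and Cn: "\<And>l. l \<in> L \<Longrightarrow> pos_def_matrix (Cn l)"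
  shows "(\<integral>x. (x $ i - mmse_estimator K p ux Cx L q un Cn H y $ i) *
      (mixture_density K p ux Cx x * mixture_density L q un Cn (y - H *v x)) \<partial>lborel) = 0"
proof -
  let ?e = "\<lambda>k l x. gaussian_density (ux k) (Cx k) x * gaussian_density (un l) (Cn l) (y - H *v x)"
  let ?f = "\<lambda>k l. gaussian_density (mean_y H (ux k) (un l)) (cov_y H (Cx k) (Cn l)) y"
  let ?m = "\<lambda>k l. component_posterior_mean H (ux k) (Cx k) (un l) (Cn l) y"
  let ?S = "\<Sum>k\<in>K. \<Sum>l\<in>L. p k * q l * ?f k l"
  define u where "u = mmse_estimator K p ux Cx L q un Cn H y"
  have f0: "?f k l > 0" if "k \<in> K" "l \<in> L" for k l
    using that by (intro gaussian_density_pos pos_def_cov_y Cx Cn)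
  obtain k0 where k0: "k0 \<in> K" "p k0 > 0" using K(2,3) by (rule sum_eq_1_obtain_pos)
  obtain l0 where l0: "l0 \<in> L" "q l0 > 0" using L(2,3) by (rule sum_eq_1_obtain_pos)
  have nn: "0 \<le> p k * q l * ?f k l" if "k \<in> K" "l \<in> L" for k l
    using f0[OF that] K(2) L(2) that by simp
  have "0 < p k0 * q l0 * ?f k0 l0" using k0 l0 f0 by simp
  also have "\<dots> \<le> (\<Sum>l\<in>L. p k0 * q l * ?f k0 l)"
    using nn k0 l0 L(1) by (intro member_le_sum[where f = "\<lambda>l. p k0 * q l * ?f k0 l"]) auto
  also have "\<dots> \<le> ?S"
    using nn k0 K(1) by (intro member_le_sum[where f = "\<lambda>k. \<Sum>l\<in>L. p k * q l * ?f k l"] sum_nonneg) auto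
  finally have S: "?S > 0" .
  \<comment> \<open>The defining fraction with its denominator cleared, which is where
    \<open>?S > 0\<close> enters.\<close>
  have u: "?S * u $ i = (\<Sum>k\<in>K. \<Sum>l\<in>L. p k * q l * (?f k l * ?m k l $ i))"
    using S by (simp add: u_def mmse_estimator_def Let_def mult.assoc)
  have e: "mixture_density K p ux Cx x * mixture_density L q un Cn (y - H *v x) = (\<Sum>k\<in>K. \<Sum>l\<in>L. p k * q l * ?e k l x)" for x
    unfolding mixture_density_def sum_product by (intro sum.cong refl) (simp add: mult_ac)
  have 1: "has_bochner_integral lborel (\<lambda>x. \<Sum>k\<in>K. \<Sum>l\<in>L. p k * q l * ?e k l x) ?S"
    by (intro has_bochner_integral_sum has_bochner_integral_mult_right gaussian_posterior(1) Cx Cn)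
  have 2: "has_bochner_integral lborel (\<lambda>x. \<Sum>k\<in>K. \<Sum>l\<in>L. p k * q l * (x $ i * ?e k l x)) (?S * u $ i)"
    unfolding u by (intro has_bochner_integral_sum has_bochner_integral_mult_right gaussian_posterior(2) Cx Cn)
  have "has_bochner_integral lborel (\<lambda>x. (x $ i - u $ i) *
      (mixture_density K p ux Cx x * mixture_density L q un Cn (y - H *v x))) (?S * u $ i - u $ i * ?S)"
    unfolding e left_diff_distrib
    using has_bochner_integral_diff[OF 2 has_bochner_integral_mult_right[OF 1, of "u $ i"]]
    by (simp add: sum_distrib_left mult_ac)
  then show ?thesis unfolding u_def[symmetric] by (simp add: has_bochner_integral_iff)
qed

section \<open>The estimator as conditional expectation\<close>

text \<open>Independence speaks about preimages of pairs of Borel sets, that is, about rectangles,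
  and rectangles determine a product of sigma-finite measures.\<close>

lemma indep_random_vectors_joint_density:
  fixes X :: "'a \<Rightarrow> real^'n" and W :: "'a \<Rightarrow> real^'m"
  assumes P: "prob_space P"
    and X: "distributed P lborel X (\<lambda>x. ennreal (f x))" and W: "distributed P lborel W (\<lambda>x. ennreal (g x))"
    and f: "\<And>x. f x \<ge> 0" and indep: "indep_random_vectors P X W"
  shows "distr P (lborel \<Otimes>\<^sub>M lborel) (\<lambda>\<omega>. (X \<omega>, W \<omega>)) = density (lborel \<Otimes>\<^sub>M lborel) (\<lambda>(x, n). ennreal (f x * g n))"
proof -
  interpret prob_space P by fact
  have [measurable]: "X \<in> borel_measurable P" "W \<in> borel_measurable P"
    using distributed_measurable[OF X] distributed_measurable[OF W] by auto
  have meas: "(\<lambda>x. ennreal (f x)) \<in> borel_measurable lborel" "(\<lambda>x. ennreal (g x)) \<in> borel_measurable lborel"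
    using X W by (auto simp: distributed_def)
  have pX: "prob_space (distr P lborel X)" and pW: "prob_space (distr P lborel W)"
    by (intro prob_space_distr, simp)+
  have "distr P lborel X \<Otimes>\<^sub>M distr P lborel W = distr P (lborel \<Otimes>\<^sub>M lborel) (\<lambda>\<omega>. (X \<omega>, W \<omega>))"
  proof (rule pair_measure_eqI)
    fix A B assume "A \<in> sets (distr P lborel X)" "B \<in> sets (distr P lborel W)"
    then have [measurable]: "A \<in> sets borel" "B \<in> sets borel" by auto
    have "prob ((X -` A \<inter> space P) \<inter> (W -` B \<inter> space P)) = prob (X -` A \<inter> space P) * prob (W -` B \<inter> space P)"
      by (rule indep_setD[OF indep[unfolded indep_random_vectors_def]]) (simp_all add: in_vimage_algebra)
    moreover have "(\<lambda>\<omega>. (X \<omega>, W \<omega>)) -` (A \<times> B) \<inter> space P = (X -` A \<inter> space P) \<inter> (W -` B \<inter> space P)" by auto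
    ultimately show "emeasure (distr P lborel X) A * emeasure (distr P lborel W) B
        = emeasure (distr P (lborel \<Otimes>\<^sub>M lborel) (\<lambda>\<omega>. (X \<omega>, W \<omega>))) (A \<times> B)"
      by (simp add: emeasure_distr emeasure_eq_measure ennreal_mult)
  qed (use pX pW in \<open>auto intro!: prob_space_imp_sigma_finite cong: sets_pair_measure_cong\<close>)
  moreover have "distr P lborel X = density lborel (\<lambda>x. ennreal (f x))" "distr P lborel W = density lborel (\<lambda>x. ennreal (g x))"
    using X W by (auto simp: distributed_def)
  moreover have "density lborel (\<lambda>x. ennreal (f x)) \<Otimes>\<^sub>M density lborel (\<lambda>x. ennreal (g x))
     = density (lborel \<Otimes>\<^sub>M lborel) (\<lambda>(x, n). ennreal (f x) * ennreal (g n))"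
    using pW by (intro pair_measure_density meas lborel.sigma_finite_measure_axioms)
      (simp add: calculation prob_space_imp_sigma_finite)
  moreover have "(\<lambda>(x, n). ennreal (f x) * ennreal (g n)) = (\<lambda>(x, n). ennreal (f x * g n))"
    using f by (auto simp: ennreal_mult')
  ultimately show ?thesis by simp
qed

text \<open>For fixed \<open>x\<close> the passage from the noise to the observation is a
  translation by \<open>H *v x\<close>, so no Jacobian factor appears.\<close>

lemma observation_joint_density:
  fixes X :: "'a \<Rightarrow> real^'n" and W :: "'a \<Rightarrow> real^'m" and H :: "real^'n^'m"
  assumes P: "prob_space P"
    and X: "distributed P lborel X (\<lambda>x. ennreal (f x))" and W: "distributed P lborel W (\<lambda>x. ennreal (g x))"
    and f: "\<And>x. f x \<ge> 0" and [measurable]: "f \<in> borel_measurable borel" "g \<in> borel_measurable borel"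
    and indep: "indep_random_vectors P X W"
  shows "distr P (lborel \<Otimes>\<^sub>M lborel) (\<lambda>\<omega>. (X \<omega>, H *v X \<omega> + W \<omega>))
    = density (lborel \<Otimes>\<^sub>M lborel) (\<lambda>(x, y). ennreal (f x * g (y - H *v x)))"
proof (rule measure_eqI)
  have [measurable]: "X \<in> borel_measurable P" "W \<in> borel_measurable P"
    using distributed_measurable[OF X] distributed_measurable[OF W] by auto
  fix A :: "((real^'n) \<times> (real^'m)) set"
  assume "A \<in> sets (distr P (lborel \<Otimes>\<^sub>M lborel) (\<lambda>\<omega>. (X \<omega>, H *v X \<omega> + W \<omega>)))"
  then have A[measurable]: "A \<in> sets (borel \<Otimes>\<^sub>M borel)" by (simp cong: sets_pair_measure_cong)
  have ind[measurable]: "(\<lambda>z. indicator A z :: ennreal) \<in> borel_measurable (borel \<Otimes>\<^sub>M borel)" by measurable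
  have "emeasure (distr P (lborel \<Otimes>\<^sub>M lborel) (\<lambda>\<omega>. (X \<omega>, H *v X \<omega> + W \<omega>))) A
     = (\<integral>\<^sup>+z. indicator A z \<partial>distr P (lborel \<Otimes>\<^sub>M lborel) (\<lambda>\<omega>. (X \<omega>, H *v X \<omega> + W \<omega>)))"
    by (rule nn_integral_indicator[symmetric]) (simp cong: sets_pair_measure_cong)
  also have "\<dots> = (\<integral>\<^sup>+\<omega>. indicator A (X \<omega>, H *v X \<omega> + W \<omega>) \<partial>P)"
    by (rule nn_integral_distr) measurable
  also have "\<dots> = (\<integral>\<^sup>+z. indicator A (fst z, H *v fst z + snd z) \<partial>distr P (lborel \<Otimes>\<^sub>M lborel) (\<lambda>\<omega>. (X \<omega>, W \<omega>)))"
    by (subst nn_integral_distr) (simp_all, measurable)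
  also have "\<dots> = (\<integral>\<^sup>+z. ennreal (f (fst z) * g (snd z)) * indicator A (fst z, H *v fst z + snd z) \<partial>(lborel \<Otimes>\<^sub>M lborel))"
    unfolding indep_random_vectors_joint_density[OF P X W f indep]
    by (subst nn_integral_density) (simp_all add: split_beta')
  also have "\<dots> = (\<integral>\<^sup>+x. \<integral>\<^sup>+n. ennreal (f x * g n) * indicator A (x, H *v x + n) \<partial>lborel \<partial>lborel)"
    by (subst lborel.nn_integral_fst[symmetric]) (simp_all, measurable)
  also have "\<dots> = (\<integral>\<^sup>+x. \<integral>\<^sup>+y. ennreal (f x * g (y - H *v x)) * indicator A (x, y) \<partial>lborel \<partial>lborel)"
  proof (rule nn_integral_cong)
    fix x
    have "(\<lambda>n. ennreal (f x * g n) * indicator A (x, H *v x + n)) \<in> borel_measurable borel" by measurable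
    from nn_integral_lborel_translate[OF this, of "H *v x"]
    show "(\<integral>\<^sup>+n. ennreal (f x * g n) * indicator A (x, H *v x + n) \<partial>lborel)
       = (\<integral>\<^sup>+y. ennreal (f x * g (y - H *v x)) * indicator A (x, y) \<partial>lborel)" by simp
  qed
  also have "\<dots> = (\<integral>\<^sup>+z. ennreal (f (fst z) * g (snd z - H *v fst z)) * indicator A z \<partial>(lborel \<Otimes>\<^sub>M lborel))"
    by (subst lborel.nn_integral_fst[symmetric]) (simp_all, measurable)
  also have "\<dots> = emeasure (density (lborel \<Otimes>\<^sub>M lborel) (\<lambda>(x, y). ennreal (f x * g (y - H *v x)))) A"
    by (subst emeasure_density) (simp_all add: split_beta' cong: sets_pair_measure_cong)
  finally show "emeasure (distr P (lborel \<Otimes>\<^sub>M lborel) (\<lambda>\<omega>. (X \<omega>, H *v X \<omega> + W \<omega>))) A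
    = emeasure (density (lborel \<Otimes>\<^sub>M lborel) (\<lambda>(x, y). ennreal (f x * g (y - H *v x)))) A" .
qed simp

text \<open>An event generated by the observation is the preimage of a Borel set \<open>B\<close>.
  Its indicator depends on \<open>y\<close> alone and leaves the inner x-integral, which vanishes by
  \<open>mmse_estimator_posterior_mean\<close>. The assumptions \<open>intX\<close> and
  \<open>intu\<close> will be supplied by the exponential bounds.\<close>

lemma cond_exp_given_eq_mmse_estimator:
  fixes X :: "'a \<Rightarrow> real^'n" and W :: "'a \<Rightarrow> real^'m" and H :: "real^'n^'m"
  assumes P: "prob_space P"
    and K: "finite K" "\<And>k. k \<in> K \<Longrightarrow> p k \<ge> 0" "(\<Sum>k\<in>K. p k) = 1"
    and L: "finite L" "\<And>l. l \<in> L \<Longrightarrow> q l \<ge> 0" "(\<Sum>l\<in>L. q l) = 1"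
    and Cx: "\<And>k. k \<in> K \<Longrightarrow> pos_def_matrix (Cx k)" and Cn: "\<And>l. l \<in> L \<Longrightarrow> pos_def_matrix (Cn l)"
    and X: "distributed P lborel X (\<lambda>x. ennreal (mixture_density K p ux Cx x))"
    and W: "distributed P lborel W (\<lambda>n. ennreal (mixture_density L q un Cn n))"
    and indep: "indep_random_vectors P X W"
    and intX: "\<And>i. integrable P (\<lambda>\<omega>. X \<omega> $ i)"
    and intu: "\<And>i. integrable P (\<lambda>\<omega>. mmse_estimator K p ux Cx L q un Cn H (H *v X \<omega> + W \<omega>) $ i)"
  shows "AE \<omega> in P. cond_exp_given P X (\<lambda>\<omega>'. H *v X \<omega>' + W \<omega>') \<omega> = mmse_estimator K p ux Cx L q un Cn H (H *v X \<omega> + W \<omega>)"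
proof -
  let ?u = "mmse_estimator K p ux Cx L q un Cn H" and ?Y = "\<lambda>\<omega>. H *v X \<omega> + W \<omega>"
  let ?f = "mixture_density K p ux Cx" and ?g = "mixture_density L q un Cn"
  let ?F = "vimage_algebra (space P) ?Y borel"
  interpret prob_space P by fact
  have [measurable]: "X \<in> borel_measurable P" "W \<in> borel_measurable P"
    using distributed_measurable[OF X] distributed_measurable[OF W] by auto
  have sub: "subalgebra P ?F"
    unfolding subalgebra_def by (auto simp: sets_vimage_algebra2)
  interpret S: finite_measure_subalgebra P ?F by standard (rule sub)
  have f0: "?f x \<ge> 0" for x by (rule mixture_density_nonneg[OF K(2) Cx])
  have g0: "?g x \<ge> 0" for x by (rule mixture_density_nonneg[OF L(2) Cn])
  have YF: "?Y \<in> measurable ?F borel" by (rule measurable_vimage_algebra1) simp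
  have "AE \<omega> in P. real_cond_exp P ?F (\<lambda>\<omega>'. X \<omega>' $ i) \<omega> = ?u (?Y \<omega>) $ i" for i
  proof (rule S.real_cond_exp_charact[OF _ intX intu])
    have u[measurable]: "(\<lambda>y. ?u y $ i) \<in> borel_measurable borel"
      by (rule borel_measurable_vec_component) simp
    from measurable_compose[OF YF u] show "(\<lambda>\<omega>. ?u (?Y \<omega>) $ i) \<in> borel_measurable ?F" by simp
    fix A assume "A \<in> sets ?F"
    then obtain B where B[measurable]: "B \<in> sets borel" and A: "A = ?Y -` B \<inter> space P"
      by (auto simp: sets_vimage_algebra2)
    have [measurable]: "A \<in> sets P" unfolding A by measurable
    \<comment> \<open>Signal and estimate are kept together as one integrand in
      \<open>(x, y)\<close>, because it is their difference whose x-integral vanishes.\<close>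
    let ?\<phi> = "\<lambda>z. indicator B (snd z) * (fst z $ i - ?u (snd z) $ i) :: real"
    have \<phi>[measurable]: "?\<phi> \<in> borel_measurable (lborel \<Otimes>\<^sub>M lborel)" by measurable
    have eq: "indicator A \<omega> * (X \<omega> $ i - ?u (?Y \<omega>) $ i) = ?\<phi> (X \<omega>, ?Y \<omega>)" if "\<omega> \<in> space P" for \<omega>
      using that by (simp add: A indicator_def)
    have XY: "(\<lambda>\<omega>. (X \<omega>, ?Y \<omega>)) \<in> measurable P (lborel \<Otimes>\<^sub>M lborel)" by measurable
    have dens: "distr P (lborel \<Otimes>\<^sub>M lborel) (\<lambda>\<omega>. (X \<omega>, ?Y \<omega>))
        = density (lborel \<Otimes>\<^sub>M lborel) (\<lambda>z. ennreal (?f (fst z) * ?g (snd z - H *v fst z)))"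
      using observation_joint_density[OF P X W f0 _ _ indep, of H] by (simp add: split_beta')
    have "integrable P (\<lambda>\<omega>. indicator A \<omega> *\<^sub>R (X \<omega> $ i - ?u (?Y \<omega>) $ i))"
      by (intro integrable_mult_indicator Bochner_Integration.integrable_diff intX intu) simp
    then have "integrable P (\<lambda>\<omega>. ?\<phi> (X \<omega>, ?Y \<omega>))"
      by (rule Bochner_Integration.integrable_cong[THEN iffD1, rotated 2]) (simp_all add: eq)
    then have "integrable (distr P (lborel \<Otimes>\<^sub>M lborel) (\<lambda>\<omega>. (X \<omega>, ?Y \<omega>))) ?\<phi>"
      using integrable_distr_eq[OF XY \<phi>] by simp
    then have int: "integrable (lborel \<Otimes>\<^sub>M lborel) (\<lambda>z. (?f (fst z) * ?g (snd z - H *v fst z)) *\<^sub>R ?\<phi> z)"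
      unfolding dens using f0 g0 by (subst (asm) integrable_density) auto
    have "(\<integral>\<omega>. indicator A \<omega> * (X \<omega> $ i - ?u (?Y \<omega>) $ i) \<partial>P) = (\<integral>\<omega>. ?\<phi> (X \<omega>, ?Y \<omega>) \<partial>P)"
      by (rule Bochner_Integration.integral_cong) (simp_all add: eq)
    also have "\<dots> = (\<integral>z. ?\<phi> z \<partial>distr P (lborel \<Otimes>\<^sub>M lborel) (\<lambda>\<omega>. (X \<omega>, ?Y \<omega>)))"
      using integral_distr[OF XY \<phi>] by simp
    also have "\<dots> = (\<integral>z. (?f (fst z) * ?g (snd z - H *v fst z)) *\<^sub>R ?\<phi> z \<partial>(lborel \<Otimes>\<^sub>M lborel))"
      unfolding dens using f0 g0 by (subst integral_density) auto
    \<comment> \<open>Fubini with \<open>x\<close> inside, so that \<open>y\<close> is fixed while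
      the vanishing moment is applied.\<close>
    also have "\<dots> = (\<integral>y. \<integral>x. (?f x * ?g (y - H *v x)) *\<^sub>R ?\<phi> (x, y) \<partial>lborel \<partial>lborel)"
      using lborel_pair.integral_snd[of "\<lambda>x y. (?f x * ?g (y - H *v x)) *\<^sub>R ?\<phi> (x, y)"] int
      by (simp add: split_beta')
    also have "\<dots> = (\<integral>y. indicator B y * (\<integral>x. (x $ i - ?u y $ i) * (?f x * ?g (y - H *v x)) \<partial>lborel) \<partial>lborel)"
      by (simp add: mult_ac integral_mult_right_zero[symmetric] del: integral_mult_right_zero)
    also have "\<dots> = 0"
      using mmse_estimator_posterior_mean[OF K L Cx Cn] by simp
    finally have "(\<integral>\<omega>. indicator A \<omega> * X \<omega> $ i - indicator A \<omega> * ?u (?Y \<omega>) $ i \<partial>P) = 0"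
      by (simp add: right_diff_distrib)
    moreover have "integrable P (\<lambda>\<omega>. indicator A \<omega> * X \<omega> $ i)" "integrable P (\<lambda>\<omega>. indicator A \<omega> * ?u (?Y \<omega>) $ i)"
      using integrable_mult_indicator[OF \<open>A \<in> sets P\<close> intX] integrable_mult_indicator[OF \<open>A \<in> sets P\<close> intu] by simp_all
    ultimately show "(\<integral>\<omega>\<in>A. X \<omega> $ i \<partial>P) = (\<integral>\<omega>\<in>A. ?u (?Y \<omega>) $ i \<partial>P)"
      by (simp add: set_lebesgue_integral_def)
  qed
  \<comment> \<open>There are finitely many coordinates, so their exceptional null sets have a null
    union.\<close>
  then have "AE \<omega> in P. \<forall>i\<in>UNIV. real_cond_exp P ?F (\<lambda>\<omega>'. X \<omega>' $ i) \<omega> = ?u (?Y \<omega>) $ i"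
    by (intro AE_finite_allI) auto
  then show ?thesis
    by eventually_elim (simp add: cond_exp_given_def vec_eq_iff)
qed

section \<open>Locally uniform exponential bounds\<close>

text \<open>Differentiability in the parameter near \<open>h0\<close> with exponential bounds in \<open>z\<close> that are locally
  uniform in the parameter: stable under all operations occurring in the estimator and strong enough
  for dominated convergence against Gaussian mixtures.\<close>

definition weight :: "real \<Rightarrow> 'z::real_normed_vector \<Rightarrow> real" where
  "weight k z = exp (k * (1 + norm z))"

definition tame_deriv :: "real \<Rightarrow> ('z::real_normed_vector \<Rightarrow> 'h::real_normed_vector \<Rightarrow> real) \<Rightarrow> ('z \<Rightarrow> 'h \<Rightarrow> 'h \<Rightarrow> real) \<Rightarrow> 'h \<Rightarrow> bool" where
  "tame_deriv k F F' h \<longleftrightarrow> (\<forall>z. (F z has_derivative F' z h) (at h) \<and> \<bar>F z h\<bar> \<le> weight k z \<and>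
     (\<forall>d. \<bar>F' z h d\<bar> \<le> weight k z * norm d))"

text \<open>The order of quantifiers is the point: derivative, rate and neighbourhood are chosen
  before \<open>z\<close>, so that one \<open>weight k\<close> dominates for all nearby parameters
  at once.\<close>

definition tame_at :: "'h::real_normed_vector \<Rightarrow> ('z::real_normed_vector \<Rightarrow> 'h \<Rightarrow> real) \<Rightarrow> bool" where
  "tame_at h0 F \<longleftrightarrow> (\<exists>F' k. k \<ge> 0 \<and> (\<forall>\<^sub>F h in nhds h0. tame_deriv k F F' h))"

section \<open>Closure properties of tame functions\<close>

lemma weight_pos: "weight k z > 0"
  by (simp add: weight_def)

lemma weight_add: "weight (k + l) z = weight k z * weight l z"
  by (simp add: weight_def exp_add[symmetric] algebra_simps)

lemma weight_mono: "k \<le> l \<Longrightarrow> weight k z \<le> weight l z"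
  by (simp add: weight_def mult_right_mono)

lemma le_weight: "c \<le> weight (max 0 c) z"
proof -
  have "c \<le> max 0 c * (1 + norm z)" by (simp add: max_def algebra_simps mult_le_cancel_left1)
  also have "\<dots> \<le> exp (max 0 c * (1 + norm z))" using exp_ge_add_one_self[of "max 0 c * (1 + norm z)"] by linarith
  finally show ?thesis by (simp add: weight_def)
qed

lemma tame_derivD:
  assumes "tame_deriv k F F' h"
  shows "(F z has_derivative F' z h) (at h)" "\<bar>F z h\<bar> \<le> weight k z" "\<bar>F' z h d\<bar> \<le> weight k z * norm d"
  using assms by (auto simp: tame_deriv_def)

lemma tame_deriv_mono: "tame_deriv k F F' h \<Longrightarrow> k \<le> l \<Longrightarrow> tame_deriv l F F' h"
  unfolding tame_deriv_def by (meson weight_mono order_trans mult_right_mono norm_ge_zero)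

text \<open>A constant factor costs only a higher rate, since \<open>C * weight k z\<close> is at
  most \<open>weight (C + k) z\<close>. Later proofs may therefore be careless about
  constants.\<close>

lemma tame_atI:
  fixes F :: "'z::real_normed_vector \<Rightarrow> 'h::real_normed_vector \<Rightarrow> real"
  assumes k: "k \<ge> 0" and C: "C \<ge> 0"
    and ev: "\<forall>\<^sub>F h in nhds h0. \<forall>z. (F z has_derivative F' z h) (at h) \<and> \<bar>F z h\<bar> \<le> C * weight k z \<and>
       (\<forall>d. \<bar>F' z h d\<bar> \<le> C * weight k z * norm d)"
  shows "tame_at h0 F"
proof -
  have le: "C * weight k z \<le> weight (C + k) z" for z :: 'z
    using le_weight[of C z] C weight_pos[of k z] by (simp add: weight_add)
  have "\<forall>\<^sub>F h in nhds h0. tame_deriv (C + k) F F' h"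
    using ev by eventually_elim
      (auto simp: tame_deriv_def intro: order_trans[OF _ le] order_trans[OF _ mult_right_mono[OF le norm_ge_zero]])
  then show ?thesis
    unfolding tame_at_def using k C by (intro exI[of _ F'] exI[of _ "C + k"]) auto
qed

text \<open>The sum of the nonnegative rates dominates each of them, also for an empty family, and
  finitely many neighbourhoods can be intersected.\<close>

lemma tame_at_family:
  assumes I: "finite I" and t: "\<And>i. i \<in> I \<Longrightarrow> tame_at h0 (F i)"
  obtains F' k where "k \<ge> 0" "\<forall>\<^sub>F h in nhds h0. \<forall>i\<in>I. tame_deriv k (F i) (F' i) h"
proof -
  have "\<forall>i\<in>I. \<exists>F'k. snd F'k \<ge> 0 \<and> (\<forall>\<^sub>F h in nhds h0. tame_deriv (snd F'k) (F i) (fst F'k) h)"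
    using t by (auto simp: tame_at_def)
  then obtain D where D: "\<And>i. i \<in> I \<Longrightarrow> snd (D i) \<ge> 0"
    "\<And>i. i \<in> I \<Longrightarrow> \<forall>\<^sub>F h in nhds h0. tame_deriv (snd (D i)) (F i) (fst (D i)) h"
    by (metis (no_types, lifting))
  have le: "snd (D i) \<le> (\<Sum>i\<in>I. snd (D i))" if "i \<in> I" for i
    using that I D(1) by (intro member_le_sum) auto
  show thesis
  proof (rule that[of "\<Sum>i\<in>I. snd (D i)" "\<lambda>i. fst (D i)"])
    show "0 \<le> (\<Sum>i\<in>I. snd (D i))" by (intro sum_nonneg D(1))
    show "\<forall>\<^sub>F h in nhds h0. \<forall>i\<in>I. tame_deriv (\<Sum>i\<in>I. snd (D i)) (F i) (fst (D i)) h"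
      using I by (intro eventually_ball_finite ballI eventually_mono[OF D(2)] tame_deriv_mono[OF _ le])
  qed
qed

text \<open>The derivative in the parameter is 0, and linear growth in \<open>z\<close> stays below
  \<open>weight 1\<close>.\<close>

lemma tame_at_bounded_in_z:
  fixes c :: "'z::real_normed_vector \<Rightarrow> real" and h0 :: "'h::real_normed_vector"
  assumes "\<And>z. \<bar>c z\<bar> \<le> C * (1 + norm z)"
  shows "tame_at h0 (\<lambda>z h. c z)"
proof -
  have C: "C \<ge> 0" using assms[of 0] by simp
  have "\<bar>c z\<bar> \<le> C * weight 1 z" for z
  proof -
    have "1 + norm z \<le> weight 1 z"
      unfolding weight_def using exp_ge_add_one_self[of "1 + norm z"] by simp
    then show ?thesis using assms[of z] C by (meson mult_left_mono order_trans)
  qed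
  moreover have "0 \<le> C * weight 1 z * norm d" for z :: 'z and d :: 'h
    using C less_imp_le[OF weight_pos[of 1 z]] by (intro mult_nonneg_nonneg) auto
  ultimately show ?thesis
    using C by (intro tame_atI[where k = 1 and C = C and F' = "\<lambda>_ _ _. 0"]) auto
qed

lemma tame_at_const: "tame_at h0 (\<lambda>(z::'z::real_normed_vector) h. c)"
proof (rule tame_at_bounded_in_z[where C = "\<bar>c\<bar>"])
  show "\<bar>c\<bar> \<le> \<bar>c\<bar> * (1 + norm z)" for z :: 'z by (simp add: mult_le_cancel_left1 algebra_simps)
qed

lemma tame_at_bounded_linear:
  fixes \<phi> :: "'h::real_normed_vector \<Rightarrow> real"
  assumes \<phi>: "bounded_linear \<phi>"
  shows "tame_at h0 (\<lambda>(z::'z::real_normed_vector) h. \<phi> h)"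
proof -
  obtain K where K: "K > 0" "\<And>h. norm (\<phi> h) \<le> norm h * K"
    using bounded_linear.pos_bounded[OF \<phi>] by blast
  \<comment> \<open>On the ball \<open>norm h < norm h0 + 1\<close> this constant bounds
    \<open>\<phi> h\<close>; as it is at least \<open>K\<close>, it bounds the derivative
    too.\<close>
  define C where "C = K * (norm h0 + 1)"
  have C: "C \<ge> K" "C \<ge> 0" using K(1) by (simp_all add: C_def algebra_simps)
  have "\<forall>\<^sub>F h in nhds h0. norm h < norm h0 + 1"
    by (rule order_tendstoD(2)[where f = norm]) (auto intro: tendsto_norm filterlim_ident)
  then have "\<forall>\<^sub>F h in nhds h0. \<forall>z::'z. (\<phi> has_derivative \<phi>) (at h) \<and> \<bar>\<phi> h\<bar> \<le> C * weight 0 z \<and>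
       (\<forall>d. \<bar>\<phi> d\<bar> \<le> C * weight 0 z * norm d)"
  proof eventually_elim
    case (elim h)
    have "\<bar>\<phi> h\<bar> \<le> norm h * K" using K(2)[of h] by simp
    also have "\<dots> \<le> C" using elim K(1) by (simp add: C_def mult.commute)
    finally have "\<bar>\<phi> h\<bar> \<le> C" .
    moreover have "\<bar>\<phi> d\<bar> \<le> C * norm d" for d
      using K(2)[of d] mult_right_mono[OF C(1), of "norm d"] by (simp add: mult.commute)
    ultimately show ?case by (auto simp: weight_def intro: bounded_linear_imp_has_derivative[OF \<phi>])
  qed
  then show ?thesis using C by (intro tame_atI[where k = 0 and C = C and F' = "\<lambda>_ _. \<phi>"]) auto
qed

lemma tame_at_add:
  assumes "tame_at h0 F" "tame_at h0 G"
  shows "tame_at h0 (\<lambda>z h. F z h + G z h)"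
proof -
  from assms obtain F' k G' l where k: "k \<ge> 0" "l \<ge> 0"
    and ev: "\<forall>\<^sub>F h in nhds h0. tame_deriv k F F' h" "\<forall>\<^sub>F h in nhds h0. tame_deriv l G G' h"
    by (auto simp: tame_at_def)
  have "\<forall>\<^sub>F h in nhds h0. tame_deriv (k + l) F F' h \<and> tame_deriv (k + l) G G' h"
    using ev by eventually_elim (use k in \<open>auto intro: tame_deriv_mono\<close>)
  then have "\<forall>\<^sub>F h in nhds h0. \<forall>z. ((\<lambda>h. F z h + G z h) has_derivative (\<lambda>d. F' z h d + G' z h d)) (at h)
      \<and> \<bar>F z h + G z h\<bar> \<le> 2 * weight (k + l) z \<and> (\<forall>d. \<bar>F' z h d + G' z h d\<bar> \<le> 2 * weight (k + l) z * norm d)"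
  proof eventually_elim
    case (elim h)
    note F = tame_derivD[OF conjunct1[OF elim]] and G = tame_derivD[OF conjunct2[OF elim]]
    have "\<bar>F z h + G z h\<bar> \<le> 2 * weight (k + l) z" for z
      using F(2)[of z] G(2)[of z] by linarith
    moreover have "\<bar>F' z h d + G' z h d\<bar> \<le> 2 * weight (k + l) z * norm d" for z d
      using F(3)[of z d] G(3)[of z d] by linarith
    ultimately show ?case using has_derivative_add[OF F(1) G(1)] by blast
  qed
  then show ?thesis
    using k by (intro tame_atI[where k = "k + l" and C = 2 and F' = "\<lambda>z h d. F' z h d + G' z h d"]) auto
qed

lemma tame_at_mult:
  fixes F G :: "'z::real_normed_vector \<Rightarrow> 'h::real_normed_vector \<Rightarrow> real"
  assumes "tame_at h0 F" "tame_at h0 G"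
  shows "tame_at h0 (\<lambda>z h. F z h * G z h)"
proof -
  from assms obtain F' k G' l where k: "k \<ge> 0" "l \<ge> 0"
    and ev: "\<forall>\<^sub>F h in nhds h0. tame_deriv k F F' h" "\<forall>\<^sub>F h in nhds h0. tame_deriv l G G' h"
    by (auto simp: tame_at_def)
  from ev have "\<forall>\<^sub>F h in nhds h0. \<forall>z. ((\<lambda>h. F z h * G z h) has_derivative (\<lambda>d. F z h * G' z h d + F' z h d * G z h)) (at h)
      \<and> \<bar>F z h * G z h\<bar> \<le> 2 * weight (k + l) z \<and> (\<forall>d. \<bar>F z h * G' z h d + F' z h d * G z h\<bar> \<le> 2 * weight (k + l) z * norm d)"
  proof eventually_elim
    case (elim h)
    note F = tame_derivD[OF elim(1)] and G = tame_derivD[OF elim(2)]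
    \<comment> \<open>Rates add under multiplication by \<open>weight_add\<close>. The factor 2 in
      the claim counts the two terms of the product rule.\<close>
    have 1: "\<bar>F z h * G z h\<bar> \<le> weight (k + l) z" for z
      unfolding weight_add abs_mult using F(2) G(2) by (intro mult_mono) (auto intro: less_imp_le weight_pos)
    have 2: "\<bar>F z h * G' z h d\<bar> \<le> weight (k + l) z * norm d" for z d
      unfolding weight_add abs_mult mult.assoc using F(2) G(3) by (intro mult_mono) (auto intro: less_imp_le weight_pos)
    have 3: "\<bar>F' z h d * G z h\<bar> \<le> weight (k + l) z * norm d" for z d
    proof -
      have "\<bar>F' z h d * G z h\<bar> \<le> (weight k z * norm d) * weight l z"
        unfolding abs_mult using F(3) G(2) by (intro mult_mono) (auto intro!: less_imp_le[OF weight_pos] mult_nonneg_nonneg)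
      then show ?thesis by (simp add: weight_add mult_ac)
    qed
    have "\<bar>F z h * G z h\<bar> \<le> 2 * weight (k + l) z" for z
      using 1[of z] by linarith
    moreover have "\<bar>F z h * G' z h d + F' z h d * G z h\<bar> \<le> 2 * weight (k + l) z * norm d" for z d
      using 2[of z d] 3[of z d] by linarith
    ultimately show ?case using has_derivative_mult[OF F(1) G(1)] by blast
  qed
  then show ?thesis
    using k by (intro tame_atI[where k = "k + l" and C = 2 and F' = "\<lambda>z h d. F z h * G' z h d + F' z h d * G z h"]) auto
qed

lemma tame_at_diff:
  assumes "tame_at h0 F" "tame_at h0 G"
  shows "tame_at h0 (\<lambda>z h. F z h - G z h)"
  using tame_at_add[OF assms(1) tame_at_mult[OF tame_at_const[of h0 "-1"] assms(2)]] by simp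

lemma tame_at_sum:
  "(\<And>i. i \<in> I \<Longrightarrow> tame_at h0 (F i)) \<Longrightarrow> tame_at h0 (\<lambda>z h. \<Sum>i\<in>I. F i z h)"
  by (induction I rule: infinite_finite_induct) (simp_all add: tame_at_const tame_at_add)

lemma tame_at_prod:
  "(\<And>i. i \<in> I \<Longrightarrow> tame_at h0 (F i)) \<Longrightarrow> tame_at h0 (\<lambda>z h. \<Prod>i\<in>I. F i z h)"
  by (induction I rule: infinite_finite_induct) (simp_all add: tame_at_const tame_at_mult)

lemma tame_at_det:
  fixes A :: "'z::real_normed_vector \<Rightarrow> 'h::real_normed_vector \<Rightarrow> real^'d^'d"
  assumes "\<And>i j. tame_at h0 (\<lambda>z h. A z h $ i $ j)"
  shows "tame_at h0 (\<lambda>z h. det (A z h))"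
  unfolding det_def by (intro tame_at_sum tame_at_mult tame_at_const tame_at_prod assms)

text \<open>The inner function depends on the parameter alone, so continuity at
  \<open>\<phi> h0\<close> bounds \<open>g\<close> and \<open>g'\<close> on one neighbourhood for
  all \<open>z\<close>. An inner function varying with \<open>z\<close> would offer no such common
  neighbourhood.\<close>

lemma tame_at_compose:
  fixes \<phi> :: "'h::real_normed_vector \<Rightarrow> real" and g g' :: "real \<Rightarrow> real"
  assumes t: "tame_at h0 (\<lambda>(z::'z::real_normed_vector) h. \<phi> h)"
    and S: "open S" "\<phi> h0 \<in> S" and g: "\<And>x. x \<in> S \<Longrightarrow> (g has_real_derivative g' x) (at x)"
    and g': "continuous_on S g'"
  shows "tame_at h0 (\<lambda>(z::'z) h. g (\<phi> h))"
proof -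
  from t obtain \<Phi>' k where k: "k \<ge> 0" and ev: "\<forall>\<^sub>F h in nhds h0. tame_deriv k (\<lambda>(z::'z) h. \<phi> h) \<Phi>' h"
    by (auto simp: tame_at_def)
  \<comment> \<open>Tameness records a derivative for each \<open>z\<close>; the instance
    \<open>z = 0\<close> is used to get continuity of \<open>\<phi>\<close>.\<close>
  have "(\<phi> has_derivative \<Phi>' 0 h0) (at h0)"
    using eventually_nhds_x_imp_x[OF ev] by (rule tame_derivD(1))
  then have "isCont \<phi> h0" by (rule has_derivative_continuous)
  then have \<phi>: "(\<phi> \<longlongrightarrow> \<phi> h0) (nhds h0)" by (simp add: isCont_def tendsto_at_iff_tendsto_nhds)
  have "isCont g (\<phi> h0)" by (rule DERIV_isCont[OF g[OF S(2)]])
  then have "((\<lambda>h. g (\<phi> h)) \<longlongrightarrow> g (\<phi> h0)) (nhds h0)" by (rule isCont_tendsto_compose[OF _ \<phi>])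
  from tendsto_rabs[OF this] have e1: "\<forall>\<^sub>F h in nhds h0. \<bar>g (\<phi> h)\<bar> < \<bar>g (\<phi> h0)\<bar> + 1"
    by (rule order_tendstoD) simp
  have "isCont g' (\<phi> h0)" using g' S by (simp add: continuous_on_eq_continuous_at)
  then have "((\<lambda>h. g' (\<phi> h)) \<longlongrightarrow> g' (\<phi> h0)) (nhds h0)" by (rule isCont_tendsto_compose[OF _ \<phi>])
  from tendsto_rabs[OF this] have e2: "\<forall>\<^sub>F h in nhds h0. \<bar>g' (\<phi> h)\<bar> < \<bar>g' (\<phi> h0)\<bar> + 1"
    by (rule order_tendstoD) simp
  have e3: "\<forall>\<^sub>F h in nhds h0. \<phi> h \<in> S" using topological_tendstoD[OF \<phi> S] .
  define C where "C = \<bar>g (\<phi> h0)\<bar> + 1 + (\<bar>g' (\<phi> h0)\<bar> + 1)"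
  have C0: "C \<ge> 0" by (simp add: C_def)
  have w: "1 \<le> weight k z" for z :: 'z using k by (simp add: weight_def)
  from ev e1 e2 e3 have "\<forall>\<^sub>F h in nhds h0. \<forall>z::'z. ((\<lambda>h. g (\<phi> h)) has_derivative (\<lambda>d. g' (\<phi> h) * \<Phi>' z h d)) (at h)
     \<and> \<bar>g (\<phi> h)\<bar> \<le> C * weight k z \<and> (\<forall>d. \<bar>g' (\<phi> h) * \<Phi>' z h d\<bar> \<le> C * weight k z * norm d)"
  proof eventually_elim
    case (elim h)
    note t = tame_derivD[OF elim(1)]
    have "\<bar>g (\<phi> h)\<bar> \<le> C * weight k z" for z :: 'z
    proof -
      have "\<bar>g (\<phi> h)\<bar> \<le> C * 1" using elim(2) by (simp add: C_def)
      also have "\<dots> \<le> C * weight k z" using w[of z] C0 by (rule mult_left_mono)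
      finally show ?thesis .
    qed
    moreover have "\<bar>g' (\<phi> h) * \<Phi>' z h d\<bar> \<le> C * weight k z * norm d" for z d
      unfolding abs_mult mult.assoc using elim(3) t(3)[of z d] C0 by (intro mult_mono) (auto simp: C_def)
    moreover have "((\<lambda>h. g (\<phi> h)) has_derivative (\<lambda>d. g' (\<phi> h) * \<Phi>' z h d)) (at h)" for z
      using has_derivative_compose[OF t(1) g[OF elim(4), unfolded has_field_derivative_def]] .
    ultimately show ?case by blast
  qed
  then show ?thesis
    using k C0 by (intro tame_atI[where k = k and C = C and F' = "\<lambda>z h d. g' (\<phi> h) * \<Phi>' z h d"]) auto
qed

lemma tame_at_inverse:
  assumes "tame_at h0 (\<lambda>(z::'z::real_normed_vector) h. \<phi> h)" and "\<phi> h0 > 0"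
  shows "tame_at h0 (\<lambda>(z::'z) h. inverse (\<phi> h))"
  by (rule tame_at_compose[where S = "{0<..}" and g' = "\<lambda>x. - (inverse x * inverse x)", OF assms(1)])
     (use assms(2) in \<open>auto intro!: derivative_eq_intros continuous_intros\<close>)

lemma tame_at_ln:
  assumes "tame_at h0 (\<lambda>(z::'z::real_normed_vector) h. \<phi> h)" and "\<phi> h0 > 0"
  shows "tame_at h0 (\<lambda>(z::'z) h. ln (\<phi> h))"
  by (rule tame_at_compose[where S = "{0<..}" and g' = inverse, OF assms(1)])
     (use assms(2) in \<open>auto intro!: derivative_eq_intros continuous_intros simp: divide_inverse\<close>)

lemma tame_at_matrix_vector_mult:
  fixes A :: "'z::real_normed_vector \<Rightarrow> 'h::real_normed_vector \<Rightarrow> real^'n^'m"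
  assumes "\<And>i j. tame_at h0 (\<lambda>z h. A z h $ i $ j)" "\<And>j. tame_at h0 (\<lambda>z h. b z h $ j)"
  shows "tame_at h0 (\<lambda>z h. (A z h *v b z h) $ i)"
  unfolding matrix_vector_mult_def by (simp, intro tame_at_sum tame_at_mult assms)

lemma tame_at_inner:
  fixes a b :: "'z::real_normed_vector \<Rightarrow> 'h::real_normed_vector \<Rightarrow> real^'n"
  assumes "\<And>j. tame_at h0 (\<lambda>z h. a z h $ j)" "\<And>j. tame_at h0 (\<lambda>z h. b z h $ j)"
  shows "tame_at h0 (\<lambda>z h. a z h \<bullet> b z h)"
  unfolding inner_vec_def inner_real_def by (intro tame_at_sum tame_at_mult assms)

text \<open>Cramer's rule writes each coordinate as a quotient of determinants, which are
  polynomials in tame entries. The denominator is positive and free of \<open>z\<close>, as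
  \<open>tame_at_inverse\<close> demands.\<close>

lemma tame_at_matrix_inv_mult:
  fixes A :: "'h::real_normed_vector \<Rightarrow> real^'d^'d" and b :: "'z::real_normed_vector \<Rightarrow> 'h \<Rightarrow> real^'d"
  assumes A: "\<And>i j. tame_at h0 (\<lambda>(z::'z) h. A h $ i $ j)" and det: "\<And>h. det (A h) > 0"
    and b: "\<And>j. tame_at h0 (\<lambda>z h. b z h $ j)"
  shows "tame_at h0 (\<lambda>z h. (matrix_inv (A h) *v b z h) $ i)"
proof -
  have eq: "(matrix_inv (A h) *v b z h) $ i
      = det (\<chi> r c. if c = i then b z h $ r else A h $ r $ c) * inverse (det (A h))" for z h
  proof -
    have d: "det (A h) \<noteq> 0" using det[of h] by simp
    have "A h *v (matrix_inv (A h) *v b z h) = b z h"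
      using matrix_inv_of_det_nz[OF d] by (simp add: matrix_vector_mul_assoc)
    then show ?thesis using cramer[OF d] by (simp add: divide_inverse)
  qed
  have "tame_at h0 (\<lambda>z h. (\<chi> r c. if c = i then b z h $ r else A h $ r $ c) $ r $ c)" for r c
    using A b by (cases "c = i") simp_all
  then show ?thesis
    unfolding eq by (intro tame_at_mult tame_at_det tame_at_inverse A det)
qed

text \<open>Normalised weights are bounded by 1, and
  \<open>w i' = w i * (\<psi> i' - (\<Sum>j. w j * \<psi> j'))\<close>; no bound on \<open>exp (\<psi> i)\<close> itself is needed.\<close>

lemma tame_at_softmax:
  fixes \<psi> :: "'i \<Rightarrow> 'z::real_normed_vector \<Rightarrow> 'h::real_normed_vector \<Rightarrow> real"
  assumes I: "finite I" and c: "\<And>i. i \<in> I \<Longrightarrow> c i \<ge> 0" "a \<in> I" "c a > 0"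
    and t: "\<And>i. i \<in> I \<Longrightarrow> tame_at h0 (\<psi> i)" and i: "i \<in> I"
  shows "tame_at h0 (\<lambda>z h. c i * exp (\<psi> i z h) / (\<Sum>j\<in>I. c j * exp (\<psi> j z h)))"
proof -
  \<comment> \<open>A common rate for all exponents, since the derivative of one normalised weight
    involves every \<open>\<psi>' j\<close>.\<close>
  obtain \<psi>' k where k: "k \<ge> 0" and ev: "\<forall>\<^sub>F h in nhds h0. \<forall>i\<in>I. tame_deriv k (\<psi> i) (\<psi>' i) h"
    by (rule tame_at_family[of I h0 \<psi>, OF I t]) blast
  define S where "S z h = (\<Sum>j\<in>I. c j * exp (\<psi> j z h))" for z h
  define w where "w j z h = c j * exp (\<psi> j z h) / S z h" for j z h
  have S: "S z h > 0" for z h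
  proof -
    have "0 < c a * exp (\<psi> a z h)" using c by simp
    also have "\<dots> \<le> S z h" unfolding S_def using c I by (intro member_le_sum) auto
    finally show ?thesis .
  qed
  have w0: "w j z h \<ge> 0" if "j \<in> I" for j z h
    using c(1)[OF that] less_imp_le[OF S] by (simp add: w_def)
  have wsum: "(\<Sum>j\<in>I. w j z h) = 1" for z h
    unfolding w_def using S[of z h] by (simp add: sum_divide_distrib[symmetric] S_def[symmetric])
  have w1: "w i z h \<le> 1" for z h
    using member_le_sum[OF i _ I, of "\<lambda>j. w j z h"] w0 wsum[of z h] by auto
  define w' where "w' z h d = w i z h * (\<psi>' i z h d - (\<Sum>j\<in>I. w j z h * \<psi>' j z h d))" for z h d
  from ev have "\<forall>\<^sub>F h in nhds h0. \<forall>z. (w i z has_derivative w' z h) (at h) \<and> \<bar>w i z h\<bar> \<le> 2 * weight k z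
      \<and> (\<forall>d. \<bar>w' z h d\<bar> \<le> 2 * weight k z * norm d)"
  proof eventually_elim
    case (elim h)
    then have D: "(\<psi> j z has_derivative \<psi>' j z h) (at h)" "\<bar>\<psi>' j z h d\<bar> \<le> weight k z * norm d" if "j \<in> I" for j z d
      using that by (auto simp: tame_deriv_def)
    have E: "((\<lambda>h. c j * exp (\<psi> j z h)) has_derivative (\<lambda>d. c j * exp (\<psi> j z h) * \<psi>' j z h d)) (at h)" if "j \<in> I" for j z
      using D(1)[OF that, of z] by (auto intro!: derivative_eq_intros)
    have SD: "(S z has_derivative (\<lambda>d. \<Sum>j\<in>I. c j * exp (\<psi> j z h) * \<psi>' j z h d)) (at h)" for z
      unfolding S_def[abs_def] by (rule has_derivative_sum) (rule E)
    have "(w i z has_derivative w' z h) (at h)" for z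
    proof -
      have "(w i z has_derivative (\<lambda>d. (c i * exp (\<psi> i z h) * \<psi>' i z h d * S z h
           - c i * exp (\<psi> i z h) * (\<Sum>j\<in>I. c j * exp (\<psi> j z h) * \<psi>' j z h d)) / (S z h * S z h))) (at h)"
        unfolding w_def[abs_def] using S[of z h] by (intro has_derivative_divide' E[OF i] SD) simp
      moreover have "(c i * exp (\<psi> i z h) * \<psi>' i z h d * S z h
           - c i * exp (\<psi> i z h) * (\<Sum>j\<in>I. c j * exp (\<psi> j z h) * \<psi>' j z h d)) / (S z h * S z h) = w' z h d" for d
      proof -
        have "(\<Sum>j\<in>I. w j z h * \<psi>' j z h d) = (\<Sum>j\<in>I. c j * exp (\<psi> j z h) * \<psi>' j z h d) / S z h"
          by (simp add: w_def sum_divide_distrib)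
        then show ?thesis using S[of z h] by (simp add: w'_def w_def field_simps)
      qed
      ultimately show ?thesis by simp
    qed
    moreover have "\<bar>w i z h\<bar> \<le> 2 * weight k z" for z
    proof -
      have "\<bar>w i z h\<bar> \<le> 1" using w0[OF i, of z h] w1[of z h] by simp
      also have "1 \<le> weight k z" using k by (simp add: weight_def)
      finally show ?thesis using weight_pos[of k z] by linarith
    qed
    moreover have "\<bar>w' z h d\<bar> \<le> 2 * weight k z * norm d" for z d
    proof -
      \<comment> \<open>A convex average of the \<open>\<psi>' j\<close> inherits their common
        bound; the deviation of \<open>\<psi>' i\<close> from it costs the factor 2.\<close>
      have "\<bar>\<Sum>j\<in>I. w j z h * \<psi>' j z h d\<bar> \<le> (\<Sum>j\<in>I. w j z h * (weight k z * norm d))"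
        by (rule order_trans[OF sum_abs sum_mono]) (use w0 D(2) in \<open>auto simp: abs_mult intro!: mult_left_mono\<close>)
      also have "\<dots> = weight k z * norm d" by (simp add: sum_distrib_right[symmetric] wsum)
      finally have "\<bar>\<psi>' i z h d - (\<Sum>j\<in>I. w j z h * \<psi>' j z h d)\<bar> \<le> 2 * weight k z * norm d"
        using D(2)[OF i, of z d] by linarith
      moreover have "\<bar>w' z h d\<bar> \<le> 1 * \<bar>\<psi>' i z h d - (\<Sum>j\<in>I. w j z h * \<psi>' j z h d)\<bar>"
        unfolding w'_def abs_mult using w0[OF i, of z h] w1[of z h] by (intro mult_right_mono) auto
      ultimately show ?thesis unfolding mult_1_left by (rule order_trans[rotated])
    qed
    ultimately show ?case by blast
  qed
  then have "tame_at h0 (w i)"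
    using k by (intro tame_atI[where k = k and C = 2 and F' = w']) auto
  then show ?thesis by (simp add: w_def[abs_def] S_def)
qed

section \<open>Tameness of the estimator as a function of the matrix\<close>

lemma tame_at_fst_component:
  "tame_at h0 (\<lambda>(z :: (real^'n) \<times> 'b::real_normed_vector) h. fst z $ i)"
proof (rule tame_at_bounded_in_z[where C = 1])
  fix z :: "(real^'n) \<times> 'b"
  show "\<bar>fst z $ i\<bar> \<le> 1 * (1 + norm z)"
    using component_le_norm_cart[of "fst z" i] norm_fst_le[of "fst z" "snd z"] by simp
qed

lemma tame_at_snd_component:
  "tame_at h0 (\<lambda>(z :: 'b::real_normed_vector \<times> (real^'n)) h. snd z $ i)"
proof (rule tame_at_bounded_in_z[where C = 1])
  fix z :: "'b \<times> (real^'n)"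
  show "\<bar>snd z $ i\<bar> \<le> 1 * (1 + norm z)"
    using component_le_norm_cart[of "snd z" i] norm_snd_le[of "snd z" "fst z"] by simp
qed

lemma bounded_linear_matrix_entry: "bounded_linear (\<lambda>H :: real^'n^'m. H $ i $ j)"
  by (rule bounded_linear_compose[OF bounded_linear_vec_nth bounded_linear_vec_nth])

lemma tame_at_matrix_entry: "tame_at H0 (\<lambda>(z::'z::real_normed_vector) (H::real^'n^'m). H $ i $ j)"
  by (rule tame_at_bounded_linear[OF bounded_linear_matrix_entry])

lemma tame_at_cov_y: "tame_at H0 (\<lambda>(z::'z::real_normed_vector) H. cov_y H Cx Cn $ i $ j)"
  unfolding cov_y_def matrix_matrix_mult_def transpose_def
  by (simp, intro tame_at_add tame_at_sum tame_at_mult tame_at_const tame_at_matrix_entry)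

text \<open>Indexing by pairs in \<open>K \<times> L\<close> turns the double sums into one softmax
  average of component means. Exponents and means are built from matrix entries, coordinates of
  \<open>z\<close>, \<open>ln det\<close> and solutions of linear systems, all of which are
  tame.\<close>

lemma tame_at_mmse_estimator:
  fixes Cx :: "'k \<Rightarrow> real^'n^'n" and Cn :: "'l \<Rightarrow> real^'m^'m" and H0 :: "real^'n^'m"
  assumes K: "finite K" "\<And>k. k \<in> K \<Longrightarrow> p k \<ge> 0" "(\<Sum>k\<in>K. p k) = 1"
    and L: "finite L" "\<And>l. l \<in> L \<Longrightarrow> q l \<ge> 0" "(\<Sum>l\<in>L. q l) = 1"
    and Cx: "\<And>k. k \<in> K \<Longrightarrow> pos_def_matrix (Cx k)" and Cn: "\<And>l. l \<in> L \<Longrightarrow> pos_def_matrix (Cn l)"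
  shows "tame_at H0 (\<lambda>z H. mmse_estimator K p ux Cx L q un Cn H (H *v fst z + snd z) $ i)"
proof -
  let ?C = "\<lambda>kl H. cov_y H (Cx (fst kl)) (Cn (snd kl))"
  define b where "b kl z H = H *v fst z + snd z - mean_y H (ux (fst kl)) (un (snd kl))" for kl z H
  define v where "v kl z H = matrix_inv (?C kl H) *v b kl z H" for kl z H
  \<comment> \<open>The normalisation by the square root of the determinant varies with
    \<open>H\<close>. It is moved into the exponent as half a logarithm, which leaves coefficients
    \<open>c\<close> that are constant, as \<open>tame_at_softmax\<close> requires.\<close>
  define \<psi> where "\<psi> kl z H = (- (1/2)) * (b kl z H \<bullet> v kl z H) - (1/2) * ln (det (?C kl H))" for kl z H
  define c where "c kl = p (fst kl) * q (snd kl) / sqrt ((2 * pi) ^ CARD('m))" for kl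
  define m where "m kl z H = ux (fst kl) + Cx (fst kl) *v (transpose H *v v kl z H)" for kl z H
  have det: "det (?C kl H) > 0" if "kl \<in> K \<times> L" for kl H
    using that by (intro pos_def_matrix_det_pos pos_def_cov_y Cx Cn) auto
  have tb: "tame_at H0 (\<lambda>z H. b kl z H $ j)" for kl j
    unfolding b_def mean_y_def vector_add_component vector_minus_component
    by (intro tame_at_add tame_at_diff tame_at_matrix_vector_mult tame_at_matrix_entry
        tame_at_fst_component tame_at_snd_component tame_at_const)
  have tv: "tame_at H0 (\<lambda>z H. v kl z H $ j)" if "kl \<in> K \<times> L" for kl j
    unfolding v_def by (intro tame_at_matrix_inv_mult tame_at_cov_y det that tb)
  have t\<psi>: "tame_at H0 (\<psi> kl)" if "kl \<in> K \<times> L" for kl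
    unfolding \<psi>_def[abs_def]
    by (intro tame_at_diff tame_at_mult tame_at_const tame_at_inner tb tv that tame_at_ln tame_at_det
        tame_at_cov_y det)
  have tm: "tame_at H0 (\<lambda>z H. m kl z H $ i)" if "kl \<in> K \<times> L" for kl
  proof -
    have "tame_at H0 (\<lambda>(z::(real^'n) \<times> (real^'m)) H. transpose H $ r $ s)" for r s
      unfolding transpose_def by (simp add: tame_at_matrix_entry)
    then show ?thesis
      unfolding m_def vector_add_component
      by (intro tame_at_add tame_at_const tame_at_matrix_vector_mult tv that)
  qed
  obtain k0 where k0: "k0 \<in> K" "p k0 > 0" using K(2,3) by (rule sum_eq_1_obtain_pos)
  obtain l0 where l0: "l0 \<in> L" "q l0 > 0" using L(2,3) by (rule sum_eq_1_obtain_pos)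
  have tw: "tame_at H0 (\<lambda>z H. c kl * exp (\<psi> kl z H) / (\<Sum>j\<in>K \<times> L. c j * exp (\<psi> j z H)))"
    if "kl \<in> K \<times> L" for kl
    by (rule tame_at_softmax[where I = "K \<times> L" and c = c and \<psi> = \<psi> and a = "(k0, l0)"])
      (use that K L k0 l0 t\<psi> in \<open>auto simp: c_def\<close>)
  have "mmse_estimator K p ux Cx L q un Cn H (H *v fst z + snd z) $ i
     = (\<Sum>kl\<in>K \<times> L. c kl * exp (\<psi> kl z H) / (\<Sum>j\<in>K \<times> L. c j * exp (\<psi> j z H)) * m kl z H $ i)" for z H
  proof -
    let ?f = "\<lambda>kl. p (fst kl) * q (snd kl) * gaussian_density (mean_y H (ux (fst kl)) (un (snd kl))) (?C kl H) (H *v fst z + snd z)"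
    have f: "?f kl = c kl * exp (\<psi> kl z H)" if "kl \<in> K \<times> L" for kl
    proof -
      have "exp ((1/2) * ln (det (?C kl H))) = sqrt (det (?C kl H))"
        using det[OF that, of H] by (simp add: powr_half_sqrt[symmetric] powr_def)
      then show ?thesis
        by (simp add: gaussian_density_def c_def \<psi>_def exp_diff b_def v_def real_sqrt_mult)
    qed
    have M: "component_posterior_mean H (ux (fst kl)) (Cx (fst kl)) (un (snd kl)) (Cn (snd kl)) (H *v fst z + snd z) = m kl z H" for kl
      unfolding component_posterior_mean_def m_def v_def b_def by (simp only: matrix_vector_mul_assoc[symmetric])
    have "mmse_estimator K p ux Cx L q un Cn H (H *v fst z + snd z)
        = (1 / (\<Sum>kl\<in>K \<times> L. ?f kl)) *\<^sub>R (\<Sum>kl\<in>K \<times> L. ?f kl *\<^sub>R m kl z H)"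
      unfolding mmse_estimator_def Let_def sum.cartesian_product M[symmetric] by (simp add: split_beta')
    also have "\<dots> = (1 / (\<Sum>kl\<in>K \<times> L. c kl * exp (\<psi> kl z H))) *\<^sub>R (\<Sum>kl\<in>K \<times> L. (c kl * exp (\<psi> kl z H)) *\<^sub>R m kl z H)"
      using f by simp
    finally show ?thesis by (simp add: sum_distrib_left sum_divide_distrib)
  qed
  then show ?thesis
    by (simp only:) (intro tame_at_sum tame_at_mult tw tm)
qed

section \<open>Differentiation under the integral\<close>

text \<open>The mean value inequality on the ball turns the derivative bound into a Lipschitz bound
  with the same \<open>B\<close>. The normalised remainder is then dominated by
  \<open>2 * B \<omega>\<close> and tends to 0 pointwise, which gives a full derivative rather than
  only partial ones.\<close>

lemma has_derivative_integral_dominated: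
  fixes G :: "'a \<Rightarrow> 'h::euclidean_space \<Rightarrow> real"
  assumes r: "r > 0"
    and int: "\<And>h. h \<in> ball h0 r \<Longrightarrow> integrable M (\<lambda>\<omega>. G \<omega> h)"
    and G': "\<And>\<omega> h. h \<in> ball h0 r \<Longrightarrow> (G \<omega> has_derivative G' \<omega> h) (at h)"
    and bound: "\<And>\<omega> h d. h \<in> ball h0 r \<Longrightarrow> \<bar>G' \<omega> h d\<bar> \<le> B \<omega> * norm d"
    and B: "integrable M B"
  shows "integrable M (\<lambda>\<omega>. G' \<omega> h0 d)"
    and "((\<lambda>h. \<integral>\<omega>. G \<omega> h \<partial>M) has_derivative (\<lambda>d. \<integral>\<omega>. G' \<omega> h0 d \<partial>M)) (at h0)"
proof -
  have h0: "h0 \<in> ball h0 r" using r by simp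
  note D0 = G'[OF h0]
  have lin: "linear (G' \<omega> h0)" for \<omega> by (rule has_derivative_linear[OF D0])
  have int_D: "integrable M (\<lambda>\<omega>. G' \<omega> h0 d)" for d
  proof (cases "d = 0")
    case True
    then show ?thesis by (simp add: linear_0[OF lin])
  next
    case False
    \<comment> \<open>The factor \<open>r / (2 * norm d)\<close> keeps
      \<open>h0 + t n *\<^sub>R d\<close> inside the ball. Difference quotients along this sequence
      show that the derivative is measurable in \<open>\<omega>\<close>, which is not
      assumed.\<close>
    define t where "t n = (r / (2 * norm d)) * inverse (real (Suc n))" for n
    have t0: "t n > 0" for n using r False by (simp add: t_def)
    have tball: "h0 + t n *\<^sub>R d \<in> ball h0 r" for n
    proof -
      have "norm (t n *\<^sub>R d) = r / 2 * inverse (real (Suc n))" using r False by (simp add: t_def abs_mult)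
      also have "\<dots> \<le> r / 2 * 1" using r by (intro mult_left_mono) (simp_all add: field_simps)
      finally show ?thesis using r by (simp add: dist_norm)
    qed
    have tlim: "t \<longlonglongrightarrow> 0"
      unfolding t_def[abs_def] by (intro tendsto_mult_right_zero LIMSEQ_inverse_real_of_nat)
    have "(\<lambda>n. (G \<omega> (h0 + t n *\<^sub>R d) - G \<omega> h0) / t n) \<longlonglongrightarrow> G' \<omega> h0 d" for \<omega>
    proof -
      have "((\<lambda>s. G \<omega> (h0 + s *\<^sub>R d)) has_derivative (\<lambda>s. G' \<omega> h0 (s *\<^sub>R d))) (at 0)"
        by (rule has_derivative_compose[where g = "G \<omega>"]) (auto intro!: derivative_eq_intros D0)
      moreover have "(\<lambda>s. G' \<omega> h0 (s *\<^sub>R d)) = (*) (G' \<omega> h0 d)"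
        by (simp add: fun_eq_iff linear_scale[OF lin])
      ultimately have "((\<lambda>s. G \<omega> (h0 + s *\<^sub>R d)) has_real_derivative G' \<omega> h0 d) (at 0)"
        by (simp add: has_field_derivative_def)
      then have "((\<lambda>s. (G \<omega> (h0 + s *\<^sub>R d) - G \<omega> h0) / s) \<longlongrightarrow> G' \<omega> h0 d) (at 0)"
        by (simp add: has_field_derivative_iff)
      moreover have "filterlim t (at 0) sequentially"
        using tlim t0 by (simp add: filterlim_at less_imp_neq[symmetric] eventually_sequentially)
      ultimately show ?thesis by (rule filterlim_compose)
    qed
    then have "(\<lambda>\<omega>. G' \<omega> h0 d) \<in> borel_measurable M"
      by (rule borel_measurable_LIMSEQ_real)
        (intro borel_measurable_divide borel_measurable_diff borel_measurable_const
          borel_measurable_integrable int tball h0)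
    then show ?thesis
      by (rule Bochner_Integration.integrable_bound[OF integrable_mult_left[OF B, of "norm d"]])
        (auto intro!: AE_I2 order_trans[OF bound[OF h0]])
  qed
  have lip: "\<bar>G \<omega> h - G \<omega> h0\<bar> \<le> B \<omega> * norm (h - h0)" if "h \<in> ball h0 r" for \<omega> h
  proof -
    have "norm (G \<omega> h - G \<omega> h0) \<le> B \<omega> * norm (h - h0)"
    proof (rule differentiable_bound[where S = "ball h0 r"])
      show "(G \<omega> has_derivative G' \<omega> x) (at x within ball h0 r)" if "x \<in> ball h0 r" for x
        using G'[OF that] by (rule has_derivative_at_withinI)
      show "onorm (G' \<omega> x) \<le> B \<omega>" if "x \<in> ball h0 r" for x
        using bound[OF that] by (intro onorm_le) simp
    qed (use that h0 in auto)
    then show ?thesis by simp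
  qed
  have B0: "0 \<le> B \<omega> * norm d" for \<omega> and d :: 'h
    using bound[OF h0, of \<omega> d] by linarith
  let ?I = "\<lambda>h. \<integral>\<omega>. G \<omega> h \<partial>M" and ?D = "\<lambda>d. \<integral>\<omega>. G' \<omega> h0 d \<partial>M"
  have "(?I has_derivative ?D) (at h0 within ball h0 r)"
    unfolding has_derivative_iff_norm
  proof
    have "linear ?D"
      by (rule linearI) (simp_all add: linear_add[OF lin] linear_scale[OF lin] int_D)
    then show "bounded_linear ?D" by (rule linear_conv_bounded_linear[THEN iffD1])
    show "((\<lambda>h. norm (?I h - ?I h0 - ?D (h - h0)) / norm (h - h0)) \<longlongrightarrow> 0) (at h0 within ball h0 r)"
    \<comment> \<open>Dominated convergence is applied along sequences, so the limit at
      \<open>h0\<close> is first reduced to them.\<close>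
    proof (rule tendsto_at_iff_sequentially[THEN iffD2], intro allI impI)
      fix X assume X: "\<forall>i. X i \<in> ball h0 r - {h0}" and lim: "X \<longlonglongrightarrow> h0"
      define R where "R n \<omega> = (G \<omega> (X n) - G \<omega> h0 - G' \<omega> h0 (X n - h0)) / norm (X n - h0)" for n \<omega>
      have Xb: "X n \<in> ball h0 r" and Xn: "X n \<noteq> h0" for n using X by auto
      have Rint: "integrable M (R n)" for n
        unfolding R_def by (intro integrable_divide Bochner_Integration.integrable_diff int int_D Xb h0)
      have Rnorm: "norm (R n \<omega>) \<le> 2 * B \<omega>" for n \<omega>
      proof -
        \<comment> \<open>One \<open>B \<omega>\<close> comes from the Lipschitz bound for the
          increment, the other from the derivative term.\<close>
        have "\<bar>G \<omega> (X n) - G \<omega> h0 - G' \<omega> h0 (X n - h0)\<bar> \<le> 2 * B \<omega> * norm (X n - h0)"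
          using lip[OF Xb, of \<omega> n] bound[OF h0, of \<omega> "X n - h0"] by linarith
        then show ?thesis using Xn[of n] by (simp add: R_def divide_le_eq)
      qed
      have Rlim: "(\<lambda>n. R n \<omega>) \<longlonglongrightarrow> 0" for \<omega>
      proof -
        have "((\<lambda>h. norm (G \<omega> h - G \<omega> h0 - G' \<omega> h0 (h - h0)) / norm (h - h0)) \<longlongrightarrow> 0) (at h0)"
          using D0 unfolding has_derivative_iff_norm by blast
        moreover have "filterlim X (at h0) sequentially"
          using lim Xn by (simp add: filterlim_at)
        ultimately have "(\<lambda>n. norm (G \<omega> (X n) - G \<omega> h0 - G' \<omega> h0 (X n - h0)) / norm (X n - h0)) \<longlonglongrightarrow> 0"
          by (rule filterlim_compose)
        then have "(\<lambda>n. norm (R n \<omega>)) \<longlonglongrightarrow> 0" by (simp add: R_def)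
        then show ?thesis by (rule tendsto_norm_zero_cancel)
      qed
      have "(\<lambda>n. \<integral>\<omega>. R n \<omega> \<partial>M) \<longlonglongrightarrow> (\<integral>\<omega>. 0 \<partial>M)"
        by (rule integral_dominated_convergence[where w = "\<lambda>\<omega>. 2 * B \<omega>"])
          (use Rint Rnorm Rlim B in auto)
      then have "(\<lambda>n. \<integral>\<omega>. R n \<omega> \<partial>M) \<longlonglongrightarrow> 0" by simp
      then have "(\<lambda>n. norm (\<integral>\<omega>. R n \<omega> \<partial>M)) \<longlonglongrightarrow> 0" by (rule tendsto_norm_zero)
      moreover have "norm (\<integral>\<omega>. R n \<omega> \<partial>M) = norm (?I (X n) - ?I h0 - ?D (X n - h0)) / norm (X n - h0)" for n
        unfolding R_def using int[OF Xb] int[OF h0] int_D by simp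
      ultimately show "((\<lambda>h. norm (?I h - ?I h0 - ?D (h - h0)) / norm (h - h0)) \<circ> X) \<longlonglongrightarrow> 0"
        by (simp add: o_def)
    qed
  qed
  then show "(?I has_derivative ?D) (at h0)" using at_within_open[OF h0 open_ball] by simp
  show "integrable M (\<lambda>\<omega>. G' \<omega> h0 d)" by (rule int_D)
qed

lemma tame_at_has_derivative_integral:
  fixes F :: "'z::real_normed_vector \<Rightarrow> 'h::euclidean_space \<Rightarrow> real"
  assumes t: "tame_at h0 F" and meas: "\<And>h. (\<lambda>z. F z h) \<in> borel_measurable M"
    and w: "\<And>k. integrable M (weight k)"
  obtains F' where "\<And>z. (F z has_derivative F' z) (at h0)" "\<And>d. integrable M (\<lambda>z. F' z d)"
    "((\<lambda>h. \<integral>z. F z h \<partial>M) has_derivative (\<lambda>d. \<integral>z. F' z d \<partial>M)) (at h0)"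
proof -
  from t obtain F' k where "\<forall>\<^sub>F h in nhds h0. tame_deriv k F F' h"
    by (auto simp: tame_at_def)
  then obtain r where r: "r > 0" and T: "\<And>h. h \<in> ball h0 r \<Longrightarrow> tame_deriv k F F' h"
    unfolding eventually_nhds_metric by (auto simp: dist_commute)
  have int: "integrable M (\<lambda>z. F z h)" if "h \<in> ball h0 r" for h
    by (rule Bochner_Integration.integrable_bound[OF w[of k] meas])
      (auto intro!: AE_I2 order_trans[OF tame_derivD(2)[OF T[OF that]]])
  note D = has_derivative_integral_dominated[OF r int tame_derivD(1)[OF T] tame_derivD(3)[OF T] w]
  show thesis
    by (rule that[of "\<lambda>z. F' z h0"]) (use r D tame_derivD(1)[OF T] in auto)
qed

lemma tame_at_integrable:
  assumes t: "tame_at h0 F" and "(\<lambda>z. F z h0) \<in> borel_measurable M" and w: "\<And>k. integrable M (weight k)"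
  shows "integrable M (\<lambda>z. F z h0)"
proof -
  from t obtain F' k where "\<forall>\<^sub>F h in nhds h0. tame_deriv k F F' h"
    by (auto simp: tame_at_def)
  then have "tame_deriv k F F' h0" by (rule eventually_nhds_x_imp_x)
  then show ?thesis
    by (intro Bochner_Integration.integrable_bound[OF w[of k] assms(2)])
      (auto intro!: AE_I2 order_trans[OF tame_derivD(2)[of k F F']])
qed

text \<open>A finite sum of scalar derivatives times fixed elementary matrices can be integrated
  term by term, so the interchange for matrices reduces to the scalar one.\<close>

lemma matrix_gradient_eq:
  fixes \<phi> :: "real^'n^'m \<Rightarrow> real"
  assumes D: "(\<phi> has_derivative \<phi>') (at H)"
  shows "matrix_gradient \<phi> H = (\<Sum>i\<in>UNIV. \<Sum>j\<in>UNIV. \<phi>' (axis i (axis j 1)) *\<^sub>R axis i (axis j 1))"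
proof -
  have "deriv (\<lambda>t. \<phi> (\<chi> a b. if a = i \<and> b = j then t else H $ a $ b)) (H $ i $ j) = \<phi>' (axis i (axis j 1))" for i j
  proof (rule DERIV_imp_deriv)
    let ?E = "axis i (axis j 1) :: real^'n^'m"
    \<comment> \<open>Varying a single entry is motion along an elementary matrix, with the
      parameter shifted by the current entry.\<close>
    have eq: "(\<chi> a b. if a = i \<and> b = j then t else H $ a $ b) = H + (t - H $ i $ j) *\<^sub>R ?E" for t
      by (auto simp: vec_eq_iff axis_def)
    have "((\<lambda>t. \<phi> (H + (t - H $ i $ j) *\<^sub>R ?E)) has_derivative (\<lambda>t. \<phi>' (t *\<^sub>R ?E))) (at (H $ i $ j))"
      by (rule has_derivative_compose[where g = \<phi>]) (auto intro!: derivative_eq_intros D)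
    moreover have "(\<lambda>t. \<phi>' (t *\<^sub>R ?E)) = (*) (\<phi>' ?E)"
      by (simp add: fun_eq_iff linear_scale[OF has_derivative_linear[OF D]])
    ultimately show "((\<lambda>t. \<phi> (\<chi> a b. if a = i \<and> b = j then t else H $ a $ b)) has_real_derivative \<phi>' ?E) (at (H $ i $ j))"
      unfolding eq has_field_derivative_def by simp
  qed
  then have "matrix_gradient \<phi> H = (\<chi> i j. \<phi>' (axis i (axis j 1)))"
    by (simp add: matrix_gradient_def)
  also have "\<dots> = (\<Sum>i\<in>UNIV. \<Sum>j\<in>UNIV. \<phi>' (axis i (axis j 1)) *\<^sub>R axis i (axis j 1))"
  proof (intro vec_eq_iff[THEN iffD2] allI)
    fix r :: 'm and s :: 'n
    have "(\<Sum>i\<in>UNIV. \<Sum>j\<in>UNIV. \<phi>' (axis i (axis j 1)) *\<^sub>R axis i (axis j 1)) $ r $ s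
        = (\<Sum>i\<in>UNIV. \<Sum>j\<in>UNIV. if j = s then if i = r then \<phi>' (axis i (axis j 1)) else 0 else 0)"
      unfolding sum_component by (intro sum.cong refl) (auto simp: axis_def)
    also have "\<dots> = \<phi>' (axis r (axis s 1))" by (simp only: sum.delta finite UNIV_I if_True)
    finally show "(\<chi> i j. \<phi>' (axis i (axis j 1))) $ r $ s
        = (\<Sum>i\<in>UNIV. \<Sum>j\<in>UNIV. \<phi>' (axis i (axis j 1)) *\<^sub>R axis i (axis j 1)) $ r $ s" by simp
  qed
  finally show ?thesis .
qed

section \<open>Exponential moments of Gaussian mixtures and their products\<close>

lemma integrable_exp_norm_mixture_density:
  assumes "\<And>k. k \<in> K \<Longrightarrow> pos_def_matrix (C k)"
  shows "integrable lborel (\<lambda>z. exp (a * norm z) * mixture_density K p u C z)"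
proof -
  have "integrable lborel (\<lambda>z. \<Sum>k\<in>K. p k * (exp (a * norm z) * gaussian_density (u k) (C k) z))"
    by (intro Bochner_Integration.integrable_sum integrable_mult_right integrable_exp_norm_gaussian_density assms)
  then show ?thesis by (simp add: mixture_density_def sum_distrib_left mult_ac)
qed

text \<open>The norm of a pair is at most the sum of the norms, so the weight is bounded by a
  product of one-variable exponentials and Fubini applies. The absolute value of \<open>k\<close>
  makes this estimate monotone for rates of either sign.\<close>

lemma integrable_weight_product_density:
  fixes f :: "real^'n \<Rightarrow> real" and g :: "real^'m \<Rightarrow> real"
  assumes f: "\<And>x. f x \<ge> 0" "f \<in> borel_measurable borel" "\<And>a. integrable lborel (\<lambda>x. exp (a * norm x) * f x)"
    and g: "\<And>x. g x \<ge> 0" "g \<in> borel_measurable borel" "\<And>a. integrable lborel (\<lambda>x. exp (a * norm x) * g x)"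
  shows "integrable (density (lborel \<Otimes>\<^sub>M lborel) (\<lambda>(x, n). ennreal (f x * g n))) (weight k)"
proof -
  note [measurable] = f(2) g(2)
  let ?F = "\<lambda>x. exp (\<bar>k\<bar> * norm x) * f x" and ?G = "\<lambda>n. exp (\<bar>k\<bar> * norm n) * g n"
  have wmeas[measurable]: "weight k \<in> borel_measurable (borel :: ((real^'n) \<times> (real^'m)) measure)"
    unfolding weight_def by measurable
  have wmeas': "weight k \<in> borel_measurable (lborel \<Otimes>\<^sub>M lborel :: ((real^'n) \<times> (real^'m)) measure)"
    unfolding lborel_prod by simp
  have FG: "integrable (lborel \<Otimes>\<^sub>M lborel) (\<lambda>z. ?F (fst z) * ?G (snd z))"
  proof (rule lborel_pair.Fubini_integrable)
    show "(\<lambda>z. ?F (fst z) * ?G (snd z)) \<in> borel_measurable (lborel \<Otimes>\<^sub>M lborel)" by measurable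
    have "(\<integral>y. norm (?F (fst (x, y)) * ?G (snd (x, y))) \<partial>lborel) = ?F x * (\<integral>y. ?G y \<partial>lborel)" for x
      using f(1) g(1) by (simp add: abs_mult)
    then show "integrable lborel (\<lambda>x. \<integral>y. norm (?F (fst (x, y)) * ?G (snd (x, y))) \<partial>lborel)"
      using f(3) by simp
    show "AE x in lborel. integrable lborel (\<lambda>y. ?F (fst (x, y)) * ?G (snd (x, y)))"
      using g(3) by simp
  qed
  have "integrable (lborel \<Otimes>\<^sub>M lborel) (\<lambda>z. (f (fst z) * g (snd z)) *\<^sub>R weight k z)"
  proof (rule Bochner_Integration.integrable_bound[OF integrable_mult_right[OF FG, of "exp \<bar>k\<bar>"]])
    show "(\<lambda>z. (f (fst z) * g (snd z)) *\<^sub>R weight k z) \<in> borel_measurable (lborel \<Otimes>\<^sub>M lborel)"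
      using wmeas' by measurable
    show "AE z in lborel \<Otimes>\<^sub>M lborel. norm ((f (fst z) * g (snd z)) *\<^sub>R weight k z) \<le> norm (exp \<bar>k\<bar> * (?F (fst z) * ?G (snd z)))"
    proof (rule AE_I2)
      fix z :: "(real^'n) \<times> (real^'m)"
      have "k * (1 + norm z) \<le> \<bar>k\<bar> * (1 + (norm (fst z) + norm (snd z)))"
        using norm_Pair_le[of "fst z" "snd z"] by (intro mult_mono) auto
      then have "weight k z \<le> exp \<bar>k\<bar> * exp (\<bar>k\<bar> * norm (fst z)) * exp (\<bar>k\<bar> * norm (snd z))"
        by (simp add: weight_def exp_add[symmetric] algebra_simps)
      then have "(f (fst z) * g (snd z)) * weight k z
          \<le> (f (fst z) * g (snd z)) * (exp \<bar>k\<bar> * exp (\<bar>k\<bar> * norm (fst z)) * exp (\<bar>k\<bar> * norm (snd z)))"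
        using f(1) g(1) by (intro mult_left_mono) auto
      then show "norm ((f (fst z) * g (snd z)) *\<^sub>R weight k z) \<le> norm (exp \<bar>k\<bar> * (?F (fst z) * ?G (snd z)))"
        using f(1) g(1) weight_pos[of k z] by (simp add: abs_mult mult_ac)
    qed
  qed
  then have "integrable (density (lborel \<Otimes>\<^sub>M lborel) (\<lambda>z. ennreal (f (fst z) * g (snd z)))) (weight k)"
    using f(1) g(1) by (subst integrable_density[OF wmeas']) auto
  then show ?thesis by (simp add: split_beta')
qed

theorem mainTheorem1:
  fixes P :: "'a measure"
    and X :: "'a \<Rightarrow> real ^ 'n" and W :: "'a \<Rightarrow> real ^ 'm"
    and K :: "'k set" and p :: "'k \<Rightarrow> real"
    and ux :: "'k \<Rightarrow> real ^ 'n" and Cx :: "'k \<Rightarrow> real ^ 'n ^ 'n"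
    and L :: "'l set" and q :: "'l \<Rightarrow> real"
    and un :: "'l \<Rightarrow> real ^ 'm" and Cn :: "'l \<Rightarrow> real ^ 'm ^ 'm"
    and H :: "real ^ 'n ^ 'm"
  assumes "prob_space P"
    and "finite K" and "\<And>k. k \<in> K \<Longrightarrow> p k \<ge> 0" and "(\<Sum>k\<in>K. p k) = 1"
    and "finite L" and "\<And>l. l \<in> L \<Longrightarrow> q l \<ge> 0" and "(\<Sum>l\<in>L. q l) = 1"
    and "\<And>k. k \<in> K \<Longrightarrow> pos_def_matrix (Cx k)"
    and "\<And>l. l \<in> L \<Longrightarrow> pos_def_matrix (Cn l)"
    and "distributed P lborel X (\<lambda>x. ennreal (mixture_density K p ux Cx x))"
    and "distributed P lborel W (\<lambda>n. ennreal (mixture_density L q un Cn n))"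
    and "indep_random_vectors P X W"
  shows "integrable P (\<lambda>\<omega>. (norm (cond_exp_given P X (\<lambda>\<omega>'. H *v X \<omega>' + W \<omega>') \<omega>))\<^sup>2)
    \<and> mmse_energy P X W differentiable (at H)
    \<and> (\<forall>x n. G_breve K p ux Cx L q un Cn x n differentiable (at H))
    \<and> integrable P (\<lambda>\<omega>. matrix_gradient (G_breve K p ux Cx L q un Cn (X \<omega>) (W \<omega>)) H)
    \<and> integrable (lborel \<Otimes>\<^sub>M lborel)
        (\<lambda>(x, n). (mixture_density K p ux Cx x * mixture_density L q un Cn n) *\<^sub>R
                  matrix_gradient (G_breve K p ux Cx L q un Cn x n) H)
    \<and> (LINT \<omega>|P. matrix_gradient (G_breve K p ux Cx L q un Cn (X \<omega>) (W \<omega>)) H)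
      = (LINT (x, n)|(lborel \<Otimes>\<^sub>M lborel).
           (mixture_density K p ux Cx x * mixture_density L q un Cn n) *\<^sub>R
           matrix_gradient (G_breve K p ux Cx L q un Cn x n) H)
    \<and> (LINT (x, n)|(lborel \<Otimes>\<^sub>M lborel).
           (mixture_density K p ux Cx x * mixture_density L q un Cn n) *\<^sub>R
           matrix_gradient (G_breve K p ux Cx L q un Cn x n) H)
      = matrix_gradient (mmse_energy P X W) H"
proof -
  note [measurable] = borel_measurable_mixture_density
  let ?f = "mixture_density K p ux Cx" and ?g = "mixture_density L q un Cn"
  let ?u = "mmse_estimator K p ux Cx L q un Cn"
  let ?L = "lborel \<Otimes>\<^sub>M lborel :: ((real^'n) \<times> (real^'m)) measure"
  interpret prob_space P by fact
  have XW: "X \<in> borel_measurable P" "W \<in> borel_measurable P"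
    using distributed_measurable[OF assms(10)] distributed_measurable[OF assms(11)] by auto
  note [measurable] = XW
  have f0: "?f x \<ge> 0" for x by (rule mixture_density_nonneg) (use assms in auto)
  have g0: "?g x \<ge> 0" for x by (rule mixture_density_nonneg) (use assms in auto)
  define Q where "Q = distr P ?L (\<lambda>\<omega>. (X \<omega>, W \<omega>))"
  have Q: "Q = density ?L (\<lambda>(x, n). ennreal (?f x * ?g n))"
    unfolding Q_def by (rule indep_random_vectors_joint_density[OF assms(1,10,11) f0 assms(12)])
  have measQ: "\<phi> \<in> borel_measurable Q \<longleftrightarrow> \<phi> \<in> borel_measurable ?L" for \<phi> :: "_ \<Rightarrow> 'c::topological_space"
    by (simp add: Q_def cong: measurable_cong_sets)
  have weight: "integrable Q (weight k)" for k
    unfolding Q by (intro integrable_weight_product_density f0 g0 integrable_exp_norm_mixture_density assms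
        borel_measurable_mixture_density)
  have XWL: "(\<lambda>\<omega>. (X \<omega>, W \<omega>)) \<in> measurable P ?L" by measurable

  define G where "G z H = G_breve K p ux Cx L q un Cn (fst z) (snd z) H" for z H
  \<comment> \<open>The matrix is generalised here: the energy must be identified at every matrix,
    not only at the one in the theorem.\<close>
  have tu: "tame_at H (\<lambda>z H. ?u H (H *v fst z + snd z) $ i)" for H i
    by (rule tame_at_mmse_estimator[OF assms(2-9)])
  have tG: "tame_at H G" for H
    unfolding G_def[abs_def] G_breve_def power2_norm_eq_inner by (intro tame_at_inner tu)
  have measu: "(\<lambda>z. ?u H (H *v fst z + snd z) $ i) \<in> borel_measurable Q" for H i
    unfolding measQ by measurable
  have measG: "(\<lambda>z. G z H) \<in> borel_measurable Q" for H
    unfolding measQ G_def G_breve_def by measurable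
  have intG: "integrable Q (\<lambda>z. G z H)" for H
    by (rule tame_at_integrable[OF tG measG weight])

  \<comment> \<open>Integrability is checked under the law \<open>Q\<close>, where tameness and the
    finite weights give it, and is pulled back to \<open>P\<close>.\<close>
  have intX: "integrable P (\<lambda>\<omega>. X \<omega> $ i)" for i
  proof -
    have m: "(\<lambda>z :: (real^'n) \<times> (real^'m). fst z $ i) \<in> borel_measurable Q" unfolding measQ by measurable
    have "integrable Q (\<lambda>z. fst z $ i)"
      by (rule tame_at_integrable[OF tame_at_fst_component[of H i] m weight])
    then show ?thesis using integrable_distr_eq[OF XWL, of "\<lambda>z. fst z $ i"] m[unfolded measQ] by (simp add: Q_def)
  qed
  have intu: "integrable P (\<lambda>\<omega>. ?u H (H *v X \<omega> + W \<omega>) $ i)" for H i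
    using tame_at_integrable[OF tu measu weight] integrable_distr_eq[OF XWL measu[unfolded measQ]]
    by (simp add: Q_def)
  have cond: "AE \<omega> in P. cond_exp_given P X (\<lambda>\<omega>'. H *v X \<omega>' + W \<omega>') \<omega> = ?u H (H *v X \<omega> + W \<omega>)" for H
    by (rule cond_exp_given_eq_mmse_estimator[OF assms(1-12) intX intu])
  have AEG: "AE \<omega> in P. (norm (cond_exp_given P X (\<lambda>\<omega>'. H *v X \<omega>' + W \<omega>') \<omega>))\<^sup>2 = G (X \<omega>, W \<omega>) H" for H
    using cond[of H] by eventually_elim (simp add: G_def G_breve_def)
  have meas_cond: "(\<lambda>\<omega>. (norm (cond_exp_given P X (\<lambda>\<omega>'. H *v X \<omega>' + W \<omega>') \<omega>))\<^sup>2) \<in> borel_measurable P" for H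
    unfolding cond_exp_given_def power2_norm_eq_inner inner_vec_def by (simp, measurable)
  have measGP: "(\<lambda>\<omega>. G (X \<omega>, W \<omega>) H) \<in> borel_measurable P" for H
    using measurable_compose[OF XWL measG[unfolded measQ]] .
  have intGP: "integrable P (\<lambda>\<omega>. G (X \<omega>, W \<omega>) H)" for H
    using intG integrable_distr_eq[OF XWL measG[unfolded measQ]] by (simp add: Q_def)
  \<comment> \<open>An equality of functions. The null set in \<open>AEG\<close> may change with the
    matrix, because each value of the energy uses only its own almost sure equality.\<close>
  have energy: "mmse_energy P X W = (\<lambda>H. \<integral>z. G z H \<partial>Q)"
  proof
    fix H
    have "mmse_energy P X W H = (\<integral>\<omega>. G (X \<omega>, W \<omega>) H \<partial>P)"
      unfolding mmse_energy_def by (rule integral_cong_AE[OF meas_cond measGP AEG])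
    also have "\<dots> = (\<integral>z. G z H \<partial>Q)"
      unfolding Q_def using integral_distr[OF XWL measG[unfolded measQ]] by simp
    finally show "mmse_energy P X W H = (\<integral>z. G z H \<partial>Q)" .
  qed

  obtain G' where G': "\<And>z. (G z has_derivative G' z) (at H)" "\<And>d. integrable Q (\<lambda>z. G' z d)"
    "((\<lambda>h. \<integral>z. G z h \<partial>Q) has_derivative (\<lambda>d. \<integral>z. G' z d \<partial>Q)) (at H)"
    using tame_at_has_derivative_integral[OF tG measG weight] by blast
  \<comment> \<open>The directional derivatives are scalar and integrable. Their finite combination
    is the gradient, so one statement gives integrability and value together.\<close>
  have "has_bochner_integral Q (\<lambda>z. \<Sum>i\<in>UNIV. \<Sum>j\<in>UNIV. G' z (axis i (axis j 1)) *\<^sub>R (axis i (axis j 1) :: real^'n^'m))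
     (\<Sum>i\<in>UNIV. \<Sum>j\<in>UNIV. (\<integral>z. G' z (axis i (axis j 1)) \<partial>Q) *\<^sub>R axis i (axis j 1))"
    by (intro has_bochner_integral_sum has_bochner_integral_scaleR_left has_bochner_integral_integrable G'(2))
  then have grad: "has_bochner_integral Q (\<lambda>z. matrix_gradient (G z) H) (matrix_gradient (mmse_energy P X W) H)"
    unfolding energy matrix_gradient_eq[OF G'(3)] matrix_gradient_eq[OF G'(1)] .
  let ?D = "\<lambda>z. matrix_gradient (G z) H"
  \<comment> \<open>Measurability of the gradient in \<open>(x, n)\<close> is extracted from the
    Bochner integral; both transfers of the integral below rely on it.\<close>
  have measD: "?D \<in> borel_measurable ?L"
    using borel_measurable_has_bochner_integral[OF grad] by (simp add: measQ)
  have intQ: "integrable Q ?D" and valQ: "(\<integral>z. ?D z \<partial>Q) = matrix_gradient (mmse_energy P X W) H"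
    using grad by (simp_all add: has_bochner_integral_iff)
  have fg: "(\<lambda>z. ?f (fst z) * ?g (snd z)) \<in> borel_measurable ?L" by measurable
  have Q': "Q = density ?L (\<lambda>z. ennreal (?f (fst z) * ?g (snd z)))"
    unfolding Q by (simp add: split_beta')
  \<comment> \<open>The integral over \<open>Q\<close> is read in two ways: as an expectation, since
    \<open>Q\<close> is an image of \<open>P\<close>, and as a Lebesgue integral, since
    \<open>Q\<close> has a product density.\<close>
  have P1: "integrable P (\<lambda>\<omega>. ?D (X \<omega>, W \<omega>))"
    using intQ integrable_distr_eq[OF XWL measD] by (simp add: Q_def)
  have P2: "(\<integral>\<omega>. ?D (X \<omega>, W \<omega>) \<partial>P) = (\<integral>z. ?D z \<partial>Q)"
    using integral_distr[OF XWL measD] by (simp add: Q_def)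
  have L1: "integrable ?L (\<lambda>z. (?f (fst z) * ?g (snd z)) *\<^sub>R ?D z)"
    using intQ integrable_density[OF measD fg] f0 g0 by (simp add: Q')
  have L2: "(\<integral>z. (?f (fst z) * ?g (snd z)) *\<^sub>R ?D z \<partial>?L) = (\<integral>z. ?D z \<partial>Q)"
    using integral_density[OF measD fg] f0 g0 by (simp add: Q')
  have DG: "?D z = matrix_gradient (G_breve K p ux Cx L q un Cn (fst z) (snd z)) H" for z
    by (simp add: G_def[abs_def])
  have "G_breve K p ux Cx L q un Cn x n differentiable (at H)" for x n
    using differentiableI[OF G'(1)[of "(x, n)"]] by (simp add: G_def[abs_def])
  moreover have "mmse_energy P X W differentiable (at H)"
    unfolding energy by (rule differentiableI[OF G'(3)])
  moreover have "integrable P (\<lambda>\<omega>. (norm (cond_exp_given P X (\<lambda>\<omega>'. H *v X \<omega>' + W \<omega>') \<omega>))\<^sup>2)"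
    using integrable_cong_AE[OF meas_cond measGP AEG] intGP by simp
  ultimately show ?thesis
    using P1 P2 L1 L2 valQ by (simp add: DG split_beta')
qed

end
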